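(* Let $(W,S)$ be a Coxeter system and let $(\Lambda,\Psi)$ be a section for $(W,S)$, with $\Psi(X)=(\overline{X},\mathring{X})$ for $X\in\mathcal{F}(W,S)$. Then $C(W,S)$ possesses the following group presentation: the generating set is $C_\Lambda=\{c_X\mid X\in\Lambda\}$ and the relations are - $(R_{1.a})$ $c_X^2=1$, for $X\in\Lambda$; - $(R_{2.a})$ $c_Xc_Y=c_{\omega_X(Y)}c_X$, for $X,Y,\omega_X(Y)\in\Lambda$ with $Y\in\Omega_0(X)$; - $(R_{2.b})$ $c_Xc_Yc_Zc_Y=c_{Y'}c_{Z'}c_{Y'}c_X$, for $X\in\Lambda$ and $(Y,Z),(Y',Z')\in\Psi(\Omega_0(X)\setminus\Lambda)$ with $\omega_{Y'}(Z')=\omega_X(\omega_Y(Z))$; - $(R_{2.c})$ $c_Xc_Yc_X=c_{\overline{Z}}c_{\mathring{Z}}c_{\overline{Z}}$, for $X,Y\in\Lambda$, $Y\in\Omega_0(X)$, $Z=\omega_X(Y)$ and $(X,Y)\neq\Psi(Z)$; - $(R_{3.a})$ $(c_Xc_Y)^2=1$, for $X,Y\in\Lambda$ with $Y\in\Omega_1(X)$; - $(R_{3.b})$ $(c_Xc_Yc_Xc_Z)^2=1$, for $Z\in\Lambda$ and $(X,Y)\in\Psi(\Omega_1(Z)\setminus\Lambda)$.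
   Context: A Coxeter matrix on a finite set $S$ is a symmetric matrix $(m_{s,t})_{s,t\in S}$ with diagonal entries $1$ and off-diagonal entries in $\mathbb{N}_{\ge 2}\cup\{\infty\}$. The associated Coxeter group is $W=\langle S\mid s^2=1;\ Prod(t,s,m_{s,t})=Prod(s,t,m_{s,t})$ for $s\ne t$ in $S$ with $m_{s,t}\neq\infty\rangle$, where $Prod(s,t,m)$ is the word $sts\cdots$ with $m$ letters; $(W,S)$ is the associated Coxeter system ($S$ is always finite). For $X\subseteq S$, $W_X$ is the subgroup of $W$ generated by $X$; $(W_X,X)$ is a Coxeter system. $W_X$ (or $X$) is called irreducible if there is no partition of $X$ into two non-empty subsets $X_1,X_2$ with $m_{s,t}=2$ for all $s\in X_1,t\in X_2$. $\mathcal{F}=\mathcal{F}(W,S)$ denotes the set of non-empty subsets $X\subseteq S$ such that $W_X$ is finite and irreducible. For $X\in\mathcal{F}$, $\omega_X$ is the unique element $\ne 1$ of $W_X$ that permutes $X$ by conjugation; it has order $2$. For $X,Y\in\mathcal{F}$ write $\omega_X(Y)=\omega_XY\omega_X$. For $X\in\mathcal{F}$ set $\Omega(X)=\{Y\in\mathcal{F}\mid Y\neq X\text{ and }\omega_XY\omega_X\subseteq S\}$, $\Omega_0(X)=\{Y\in\mathcal{F}\mid Y\subsetneq X\}$ and $\Omega_1(X)=\{Y\in\mathcal{F}\mid Y\cup X\text{ is not irreducible}\}$; $\Omega(X)$ is the disjoint union of $\Omega_0(X)$ and $\Omega_1(X)$. For $Y\in\Omega_0(X)$ one has $\omega_X(Y)\in\Omega_0(X)$,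 and for $Y\in\Omega_1(X)$ one has $\omega_X(Y)=Y$. The cactus group $C(W,S)$ is the group with generators $c_X$, $X\in\mathcal{F}$, and relations: $(R_1)$ $c_X^2=1$ for $X\in\mathcal{F}$; $(R_2)$ $c_Xc_Y=c_{\omega_X(Y)}c_X$ for $X\in\mathcal{F}$, $Y\in\Omega_0(X)$; $(R_3)$ $c_Yc_X=c_Xc_Y$ for $X\in\mathcal{F}$, $Y\in\Omega_1(X)$. Sections: let $\Lambda\subseteq\mathcal{F}$. A map $\Psi:\mathcal{F}\to\Lambda\times\Lambda$, $X\mapsto(\overline{X},\mathring{X})$, is a section map for $(W,S)$ when (a) for all $X\in\Lambda$, $\mathring{X}=\overline{X}=X$; (b) for all $X\in\mathcal{F}$, $\mathring{X}\subseteq\overline{X}$ and $\omega_{\overline{X}}(\mathring{X})=X$; (c) for any $Y,Z\in\mathcal{F}$ with $Y\cup Z$ not irreducible, there exists $X\in\Lambda$ such that $Y,Z\in\Omega(X)$ and $\{\omega_X(Y),\omega_X(Z)\}\cap\Lambda\neq\emptyset$. Then $(\Lambda,\Psi)$ is called a section for $(W,S)$. "Possesses the presentation" means that the indicated elements $c_X\in C(W,S)$, $X\in\Lambda$, generate $C(W,S)$ with the listed relations as defining relations. *)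

theory Defs
  imports "HOL-Algebra.Generated_Groups" "HOL-Library.Extended_Nat"
begin

section \<open>Groups given by generators and relations\<close>

text \<open>
  A word over a set \<open>I\<close> of generators is a list of signed letters: \<open>(i, True)\<close> stands for \<open>i\<close> and
  \<open>(i, False)\<close> for its formal inverse. A relation \<open>u = v\<close> is the pair \<open>(u, v)\<close> of words.
\<close>

type_synonym 'i word = "('i \<times> bool) list"

definition words :: "'i set \<Rightarrow> 'i word set" where
  "words I = lists (I \<times> UNIV)"

definition pos :: "'i list \<Rightarrow> 'i word" where
  "pos xs = map (\<lambda>i. (i, True)) xs"

text \<open>
  The least congruence on words over \<open>I\<close> that makes signed letters mutually inverse and
  identifies both sides of each relation in \<open>R\<close>.
\<close>

inductive pres_eq :: "'i set \<Rightarrow> ('i word \<times> 'i word) set \<Rightarrow> 'i word \<Rightarrow> 'i word \<Rightarrow> bool"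
  for I R where
  refl: "w \<in> words I \<Longrightarrow> pres_eq I R w w"
| sym: "pres_eq I R u v \<Longrightarrow> pres_eq I R v u"
| trans: "pres_eq I R u v \<Longrightarrow> pres_eq I R v w \<Longrightarrow> pres_eq I R u w"
| append: "pres_eq I R u u' \<Longrightarrow> pres_eq I R v v' \<Longrightarrow> pres_eq I R (u @ v) (u' @ v')"
| cancel: "i \<in> I \<Longrightarrow> pres_eq I R [(i, b), (i, \<not> b)] []"
| relation: "(u, v) \<in> R \<Longrightarrow> u \<in> words I \<Longrightarrow> v \<in> words I \<Longrightarrow> pres_eq I R u v"

definition pres_class :: "'i set \<Rightarrow> ('i word \<times> 'i word) set \<Rightarrow> 'i word \<Rightarrow> 'i word set" where
  "pres_class I R w = {v. pres_eq I R w v}"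

definition presented_group :: "'i set \<Rightarrow> ('i word \<times> 'i word) set \<Rightarrow> 'i word set monoid" where
  "presented_group I R =
    \<lparr>carrier = pres_class I R ` words I,
     mult = (\<lambda>A B. \<Union>u\<in>A. \<Union>v\<in>B. pres_class I R (u @ v)),
     one = pres_class I R []\<rparr>"

definition pres_gen :: "'i set \<Rightarrow> ('i word \<times> 'i word) set \<Rightarrow> 'i \<Rightarrow> 'i word set" where
  "pres_gen I R i = pres_class I R (pos [i])"

text \<open>
  The canonical map from the presented group is an isomorphism onto \<open>G\<close>, that is, \<open>G\<close> possesses
  the presentation with generators \<open>c i\<close>, for \<open>i \<in> I\<close>, and defining relations \<open>R\<close>.
\<close>

definition has_presentation ::
  "('g, 'b) monoid_scheme \<Rightarrow> 'i set \<Rightarrow> ('i word \<times> 'i word) set \<Rightarrow> ('i \<Rightarrow> 'g) \<Rightarrow> bool" where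
  "has_presentation G I R c \<longleftrightarrow>
     group G \<and> (\<exists>\<phi> \<in> iso (presented_group I R) G. \<forall>i\<in>I. \<phi> (pres_gen I R i) = c i)"

lemma pres_eq_words:
  assumes "pres_eq I R u v"
  shows "u \<in> words I \<and> v \<in> words I"
  using assms by induction (auto simp: words_def)

lemma pres_class_eq_iff:
  assumes "u \<in> words I"
  shows "pres_class I R u = pres_class I R v \<longleftrightarrow> pres_eq I R u v"
proof
  assume "pres_class I R u = pres_class I R v"
  moreover have "u \<in> pres_class I R u"
    using assms by (simp add: pres_class_def pres_eq.refl)
  ultimately show "pres_eq I R u v"
    by (simp add: pres_class_def pres_eq.sym)
next
  assume uv: "pres_eq I R u v"
  have "pres_eq I R u w \<longleftrightarrow> pres_eq I R v w" for w
    using uv pres_eq.sym pres_eq.trans by metis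
  then show "pres_class I R u = pres_class I R v"
    by (simp add: pres_class_def)
qed

lemma presented_group_mult:
  assumes "u \<in> words I" "v \<in> words I"
  shows "pres_class I R u \<otimes>\<^bsub>presented_group I R\<^esub> pres_class I R v = pres_class I R (u @ v)"
proof -
  have "pres_class I R (u' @ v') = pres_class I R (u @ v)"
    if "u' \<in> pres_class I R u" "v' \<in> pres_class I R v" for u' v'
  proof -
    have "pres_eq I R (u' @ v') (u @ v)"
      using that by (simp add: pres_class_def pres_eq.append pres_eq.sym)
    then show ?thesis
      using pres_class_eq_iff[of "u' @ v'"] pres_eq_words by metis
  qed
  moreover have "u \<in> pres_class I R u" "v \<in> pres_class I R v"
    using assms by (simp_all add: pres_class_def pres_eq.refl)
  ultimately have "(\<Union>u'\<in>pres_class I R u. \<Union>v'\<in>pres_class I R v. pres_class I R (u' @ v'))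
      = pres_class I R (u @ v)"
    by blast
  then show ?thesis
    by (simp add: presented_group_def)
qed

lemma pres_eq_inverse:
  assumes "w \<in> words I"
  shows "pres_eq I R (rev (map (\<lambda>(i, b). (i, \<not> b)) w) @ w) []"
  using assms
proof (induction w)
  case Nil
  then show ?case by (simp add: words_def pres_eq.refl)
next
  case (Cons x w)
  obtain i b where x: "x = (i, b)" by fastforce
  let ?inv = "rev (map (\<lambda>(i, b). (i, \<not> b)) w)"
  have i: "i \<in> I" and w: "w \<in> words I"
    using Cons.prems by (auto simp: x words_def)
  have inv: "?inv \<in> words I"
    using w by (force simp: words_def)
  have "pres_eq I R ([(i, \<not> b), (i, b)] @ w) ([] @ w)"
    using pres_eq.append[OF pres_eq.cancel[OF i, of R "\<not> b"] pres_eq.refl[OF w]] by simp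
  then have "pres_eq I R (?inv @ ([(i, \<not> b), (i, b)] @ w)) (?inv @ ([] @ w))"
    by (rule pres_eq.append[OF pres_eq.refl[OF inv]])
  then have "pres_eq I R (?inv @ ([(i, \<not> b), (i, b)] @ w)) (?inv @ w)"
    by simp
  from pres_eq.trans[OF this Cons.IH[OF w]] show ?case
    by (simp add: x)
qed

lemma group_presented_group: "group (presented_group I R)"
proof (rule groupI)
  have carr: "carrier (presented_group I R) = pres_class I R ` words I"
    and one: "\<one>\<^bsub>presented_group I R\<^esub> = pres_class I R []"
    by (simp_all add: presented_group_def)
  have app: "u @ v \<in> words I" if "u \<in> words I" "v \<in> words I" for u v :: "'a word"
    using that by (simp add: words_def)
  have nil: "[] \<in> words I" by (simp add: words_def)
  show "\<one>\<^bsub>presented_group I R\<^esub> \<in> carrier (presented_group I R)"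
    using nil by (simp add: carr one)
  fix x assume "x \<in> carrier (presented_group I R)"
  then obtain u where u: "u \<in> words I" "x = pres_class I R u" by (auto simp: carr)
  show "\<one>\<^bsub>presented_group I R\<^esub> \<otimes>\<^bsub>presented_group I R\<^esub> x = x"
    by (simp add: u one nil presented_group_mult)
  let ?v = "rev (map (\<lambda>(i, b). (i, \<not> b)) u)"
  have "?v \<in> words I" using u(1) by (force simp: words_def)
  moreover have "pres_class I R (?v @ u) = pres_class I R []"
    using pres_eq_inverse[OF u(1)] pres_class_eq_iff[of "?v @ u"] pres_eq_words by metis
  ultimately show
    "\<exists>y\<in>carrier (presented_group I R). y \<otimes>\<^bsub>presented_group I R\<^esub> x = \<one>\<^bsub>presented_group I R\<^esub>"
    using u by (intro bexI[of _ "pres_class I R ?v"]) (auto simp: carr one presented_group_mult)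
  fix y assume "y \<in> carrier (presented_group I R)"
  then obtain v where v: "v \<in> words I" "y = pres_class I R v" by (auto simp: carr)
  show "x \<otimes>\<^bsub>presented_group I R\<^esub> y \<in> carrier (presented_group I R)"
    using u v app by (auto simp: carr presented_group_mult)
  fix z assume "z \<in> carrier (presented_group I R)"
  then obtain w where w: "w \<in> words I" "z = pres_class I R w" by (auto simp: carr)
  show "x \<otimes>\<^bsub>presented_group I R\<^esub> y \<otimes>\<^bsub>presented_group I R\<^esub> z
      = x \<otimes>\<^bsub>presented_group I R\<^esub> (y \<otimes>\<^bsub>presented_group I R\<^esub> z)"
    using u v w app by (simp add: presented_group_mult)
qed

lemma presented_group_has_presentation:
  "has_presentation (presented_group I R) I R (pres_gen I R)"
  unfolding has_presentation_def
  by (intro conjI group_presented_group bexI[OF _ iso_set_refl] ballI HOL.refl)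


section \<open>Coxeter systems\<close>

definition coxeter_matrix :: "'a set \<Rightarrow> ('a \<Rightarrow> 'a \<Rightarrow> enat) \<Rightarrow> bool" where
  "coxeter_matrix S m \<longleftrightarrow>
     finite S \<and>
     (\<forall>s\<in>S. m s s = 1) \<and>
     (\<forall>s\<in>S. \<forall>t\<in>S. m s t = m t s) \<and>
     (\<forall>s\<in>S. \<forall>t\<in>S. s \<noteq> t \<longrightarrow> 2 \<le> m s t)"

fun alt_prod :: "'a \<Rightarrow> 'a \<Rightarrow> nat \<Rightarrow> 'a list" where
  "alt_prod s t 0 = []"
| "alt_prod s t (Suc n) = s # alt_prod t s n"

definition coxeter_relations :: "'a set \<Rightarrow> ('a \<Rightarrow> 'a \<Rightarrow> enat) \<Rightarrow> ('a word \<times> 'a word) set" where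
  "coxeter_relations S m =
     {(pos [s, s], []) | s. s \<in> S} \<union>
     {(pos (alt_prod t s n), pos (alt_prod s t n)) | s t n.
        s \<in> S \<and> t \<in> S \<and> s \<noteq> t \<and> m s t = enat n}"

text \<open>
  \<open>S\<close> is a set of elements of \<open>W\<close>, so that \<open>W\<close> is the group presented by \<open>S\<close> and the Coxeter
  relations up to an isomorphism sending each generator to the element \<open>s\<close> itself.
\<close>

definition coxeter_system ::
  "('a, 'b) monoid_scheme \<Rightarrow> 'a set \<Rightarrow> ('a \<Rightarrow> 'a \<Rightarrow> enat) \<Rightarrow> bool" where
  "coxeter_system W S m \<longleftrightarrow>
     S \<subseteq> carrier W \<and> coxeter_matrix S m \<and>
     has_presentation W S (coxeter_relations S m) (\<lambda>s. s)"

definition irreducible_subset :: "('a \<Rightarrow> 'a \<Rightarrow> enat) \<Rightarrow> 'a set \<Rightarrow> bool" where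
  "irreducible_subset m X \<longleftrightarrow>
     \<not> (\<exists>X\<^sub>1 X\<^sub>2. X\<^sub>1 \<union> X\<^sub>2 = X \<and> X\<^sub>1 \<inter> X\<^sub>2 = {} \<and> X\<^sub>1 \<noteq> {} \<and> X\<^sub>2 \<noteq> {} \<and>
          (\<forall>s\<in>X\<^sub>1. \<forall>t\<in>X\<^sub>2. m s t = 2))"

text \<open>The set \<open>\<F>(W, S)\<close>; the parabolic subgroup \<open>W\<^sub>X\<close> is \<^term>\<open>generate W X\<close>.\<close>

definition fin_irred ::
  "('a, 'b) monoid_scheme \<Rightarrow> 'a set \<Rightarrow> ('a \<Rightarrow> 'a \<Rightarrow> enat) \<Rightarrow> 'a set set" where
  "fin_irred W S m =
     {X. X \<subseteq> S \<and> X \<noteq> {} \<and> finite (generate W X) \<and> irreducible_subset m X}"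

text \<open>Only meaningful for \<^term>\<open>X \<in> fin_irred W S m\<close>, where the described element is unique.\<close>

definition omega :: "('a, 'b) monoid_scheme \<Rightarrow> 'a set \<Rightarrow> 'a" where
  "omega W X =
     (THE w. w \<in> generate W X \<and> w \<noteq> \<one>\<^bsub>W\<^esub> \<and> (\<lambda>x. w \<otimes>\<^bsub>W\<^esub> x \<otimes>\<^bsub>W\<^esub> inv\<^bsub>W\<^esub> w) ` X = X)"

definition omega_conj :: "('a, 'b) monoid_scheme \<Rightarrow> 'a set \<Rightarrow> 'a set \<Rightarrow> 'a set" where
  "omega_conj W X Y = (\<lambda>y. omega W X \<otimes>\<^bsub>W\<^esub> y \<otimes>\<^bsub>W\<^esub> omega W X) ` Y"

definition Omega ::
  "('a, 'b) monoid_scheme \<Rightarrow> 'a set \<Rightarrow> ('a \<Rightarrow> 'a \<Rightarrow> enat) \<Rightarrow> 'a set \<Rightarrow> 'a set set" where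
  "Omega W S m X = {Y \<in> fin_irred W S m. Y \<noteq> X \<and> omega_conj W X Y \<subseteq> S}"

definition Omega\<^sub>0 ::
  "('a, 'b) monoid_scheme \<Rightarrow> 'a set \<Rightarrow> ('a \<Rightarrow> 'a \<Rightarrow> enat) \<Rightarrow> 'a set \<Rightarrow> 'a set set" where
  "Omega\<^sub>0 W S m X = {Y \<in> fin_irred W S m. Y \<subset> X}"

definition Omega\<^sub>1 ::
  "('a, 'b) monoid_scheme \<Rightarrow> 'a set \<Rightarrow> ('a \<Rightarrow> 'a \<Rightarrow> enat) \<Rightarrow> 'a set \<Rightarrow> 'a set set" where
  "Omega\<^sub>1 W S m X = {Y \<in> fin_irred W S m. \<not> irreducible_subset m (Y \<union> X)}"


section \<open>Cactus groups\<close>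

definition cactus_relations ::
  "('a, 'b) monoid_scheme \<Rightarrow> 'a set \<Rightarrow> ('a \<Rightarrow> 'a \<Rightarrow> enat) \<Rightarrow> ('a set word \<times> 'a set word) set" where
  "cactus_relations W S m =
     {(pos [X, X], []) | X. X \<in> fin_irred W S m} \<union>
     {(pos [X, Y], pos [omega_conj W X Y, X]) | X Y.
        X \<in> fin_irred W S m \<and> Y \<in> Omega\<^sub>0 W S m X} \<union>
     {(pos [Y, X], pos [X, Y]) | X Y.
        X \<in> fin_irred W S m \<and> Y \<in> Omega\<^sub>1 W S m X}"

definition cactus_group ::
  "('a, 'b) monoid_scheme \<Rightarrow> 'a set \<Rightarrow> ('a \<Rightarrow> 'a \<Rightarrow> enat) \<Rightarrow> 'a set word set monoid" where
  "cactus_group W S m = presented_group (fin_irred W S m) (cactus_relations W S m)"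

definition cactus_gen ::
  "('a, 'b) monoid_scheme \<Rightarrow> 'a set \<Rightarrow> ('a \<Rightarrow> 'a \<Rightarrow> enat) \<Rightarrow> 'a set \<Rightarrow> 'a set word set" where
  "cactus_gen W S m = pres_gen (fin_irred W S m) (cactus_relations W S m)"


section \<open>Sections\<close>

text \<open>
  In \<^term>\<open>\<Psi> X\<close> the first component is the larger set \<open>X\<close>-bar and the second one is \<open>X\<close>-ring.
  Values of \<open>\<Psi>\<close> outside \<open>\<F>(W, S)\<close> are irrelevant.
\<close>

definition is_section ::
  "('a, 'b) monoid_scheme \<Rightarrow> 'a set \<Rightarrow> ('a \<Rightarrow> 'a \<Rightarrow> enat) \<Rightarrow>
   'a set set \<Rightarrow> ('a set \<Rightarrow> 'a set \<times> 'a set) \<Rightarrow> bool" where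
  "is_section W S m \<Lambda> \<Psi> \<longleftrightarrow>
     \<Lambda> \<subseteq> fin_irred W S m \<and>
     (\<forall>X\<in>fin_irred W S m. \<Psi> X \<in> \<Lambda> \<times> \<Lambda>) \<and>
     (\<forall>X\<in>\<Lambda>. \<Psi> X = (X, X)) \<and>
     (\<forall>X\<in>fin_irred W S m.
        snd (\<Psi> X) \<subseteq> fst (\<Psi> X) \<and> omega_conj W (fst (\<Psi> X)) (snd (\<Psi> X)) = X) \<and>
     (\<forall>Y\<in>fin_irred W S m. \<forall>Z\<in>fin_irred W S m.
        \<not> irreducible_subset m (Y \<union> Z) \<longrightarrow>
        (\<exists>X\<in>\<Lambda>. Y \<in> Omega W S m X \<and> Z \<in> Omega W S m X \<and>
                 {omega_conj W X Y, omega_conj W X Z} \<inter> \<Lambda> \<noteq> {}))"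

definition section_relations ::
  "('a, 'b) monoid_scheme \<Rightarrow> 'a set \<Rightarrow> ('a \<Rightarrow> 'a \<Rightarrow> enat) \<Rightarrow>
   'a set set \<Rightarrow> ('a set \<Rightarrow> 'a set \<times> 'a set) \<Rightarrow> ('a set word \<times> 'a set word) set" where
  "section_relations W S m \<Lambda> \<Psi> =
     {(pos [X, X], []) | X. X \<in> \<Lambda>} \<union>
     {(pos [X, Y], pos [omega_conj W X Y, X]) | X Y.
        X \<in> \<Lambda> \<and> Y \<in> \<Lambda> \<and> omega_conj W X Y \<in> \<Lambda> \<and> Y \<in> Omega\<^sub>0 W S m X} \<union>
     {(pos [X, Y, Z, Y], pos [Y', Z', Y', X]) | X Y Z Y' Z'.
        X \<in> \<Lambda> \<and>
        (Y, Z) \<in> \<Psi> ` (Omega\<^sub>0 W S m X - \<Lambda>) \<and>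
        (Y', Z') \<in> \<Psi> ` (Omega\<^sub>0 W S m X - \<Lambda>) \<and>
        omega_conj W Y' Z' = omega_conj W X (omega_conj W Y Z)} \<union>
     {(pos [X, Y, X], pos [fst (\<Psi> Z), snd (\<Psi> Z), fst (\<Psi> Z)]) | X Y Z.
        X \<in> \<Lambda> \<and> Y \<in> \<Lambda> \<and> Y \<in> Omega\<^sub>0 W S m X \<and>
        Z = omega_conj W X Y \<and> (X, Y) \<noteq> \<Psi> Z} \<union>
     {(pos [X, Y, X, Y], []) | X Y.
        X \<in> \<Lambda> \<and> Y \<in> \<Lambda> \<and> Y \<in> Omega\<^sub>1 W S m X} \<union>
     {(pos [X, Y, X, Z, X, Y, X, Z], []) | X Y Z.
        Z \<in> \<Lambda> \<and> (X, Y) \<in> \<Psi> ` (Omega\<^sub>1 W S m Z - \<Lambda>)}"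

end

theory Submission
  imports Defs
begin

text \<open>
  Write \<open>X'\<close> and \<open>X''\<close> for the two components of \<open>\<Psi> X\<close> (\<open>bar X\<close> and \<open>ring X\<close> below), so that
  \<open>X'' \<subseteq> X'\<close> and \<open>\<omega>\<^bsub>X'\<^esub>(X'') = X\<close>. The group presented over \<open>\<Lambda>\<close> maps to the cactus group by
  \<open>c\<^sub>X \<mapsto> c\<^sub>X\<close>. The inverse sends \<open>c\<^sub>X\<close>, for arbitrary \<open>X \<in> \<F>\<close>, to \<open>d\<^sub>X = c\<^bsub>X'\<^esub> c\<^bsub>X''\<^esub> c\<^bsub>X'\<^esub>\<close>: in the
  cactus group this product is \<open>c\<^sub>X\<close>, by the nesting relation \<open>c\<^sub>X c\<^sub>Y = c\<^bsub>\<omega>(Y)\<^esub> c\<^sub>X\<close> for the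
  pair \<open>X'' \<subset> X'\<close> (for \<open>X \<in> \<Lambda>\<close>, where \<open>X'' = X' = X\<close>, since \<open>c\<^sub>X\<^sup>2 = 1\<close>).
  The two maps are visibly inverse on generators; what has to be shown is that each family
  satisfies the other's relations.

  \<^item> The relations over \<open>\<Lambda>\<close> are instances of the cactus relations in which every \<open>c\<^sub>X\<close> with
    \<open>X \<notin> \<Lambda>\<close> is expanded by this formula (\<open>section_relations_hold\<close>).

  \<^item> Conversely (\<open>cactus_relations_hold\<close>), let first \<open>X \<in> \<Lambda>\<close> and \<open>Y \<subset> X\<close>. If \<open>Y\<close> or \<open>\<omega>\<^sub>X(Y)\<close> lies in
    \<open>\<Lambda>\<close>, the nesting relation \<open>d\<^sub>X d\<^sub>Y = d\<^bsub>\<omega>(Y)\<^esub> d\<^sub>X\<close> follows from \<open>c\<^sub>X c\<^sub>Y c\<^sub>X = d\<^bsub>\<omega>(Y)\<^esub>\<close> or from the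
    same equation for \<open>\<omega>\<^sub>X(Y)\<close> in place of \<open>Y\<close>; if neither does, it is itself a relation over \<open>\<Lambda>\<close>.
    For \<open>X \<notin> \<Lambda>\<close> one passes \<open>d\<^sub>Y\<close> through the three factors of \<open>d\<^sub>X\<close> in turn; the outcome is right
    because \<open>\<omega>\<^sub>X = \<omega>\<^bsub>X'\<^esub> \<omega>\<^bsub>X''\<^esub> \<omega>\<^bsub>X'\<^esub>\<close>. For the commutation relations, the covering property of a section
    supplies an \<open>X \<in> \<Lambda>\<close> such that conjugation by \<open>c\<^sub>X\<close> moves the given pair to one with a member
    in \<open>\<Lambda>\<close>, and commutation of such a pair is a relation over \<open>\<Lambda>\<close>.

  The facts about \<open>\<omega>\<^sub>X\<close> that enter here (existence, uniqueness, and \<open>\<Omega>(X) = \<Omega>\<^sub>0(X) \<union> \<Omega>\<^sub>1(X)\<close>) are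
  derived from the presentation of \<open>W\<close> with a single tool, the set \<open>N(w)\<close> of right inversions
  of \<open>w\<close>. It is defined by an action of \<open>W\<close> on \<open>W \<times> bool\<close> and obeys the cocycle rule
  \<open>N(u v) = N(v) \<triangle> v\<^sup>-\<^sup>1 N(u) v\<close> (\<open>inversions_mult\<close>). Only one fact lies beyond it: distinct generators
  \<open>s\<close>, \<open>t\<close> commute only if \<open>m s t = 2\<close>. This is what the geometric representation is used for
  (\<open>m_eq_2_iff\<close>).
\<close>

section \<open>Groups given by generators and relations\<close>

definition list_prod :: "('g, 'b) monoid_scheme \<Rightarrow> ('i \<Rightarrow> 'g) \<Rightarrow> 'i list \<Rightarrow> 'g" where
  "list_prod G f xs = foldr (\<lambda>i a. f i \<otimes>\<^bsub>G\<^esub> a) xs \<one>\<^bsub>G\<^esub>"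

lemma list_prod_simps [simp]:
  "list_prod G f [] = \<one>\<^bsub>G\<^esub>"
  "list_prod G f (x # xs) = f x \<otimes>\<^bsub>G\<^esub> list_prod G f xs"
  by (simp_all add: list_prod_def)

definition signed_prod :: "('g, 'b) monoid_scheme \<Rightarrow> ('i \<Rightarrow> 'g) \<Rightarrow> 'i word \<Rightarrow> 'g" where
  "signed_prod G f = list_prod G (\<lambda>(i, b). if b then f i else inv\<^bsub>G\<^esub> f i)"

lemma signed_prod_simps [simp]:
  "signed_prod G f [] = \<one>\<^bsub>G\<^esub>"
  "signed_prod G f ((i, b) # w) = (if b then f i else inv\<^bsub>G\<^esub> f i) \<otimes>\<^bsub>G\<^esub> signed_prod G f w"
  by (simp_all add: signed_prod_def)

lemma words_Nil [simp]: "[] \<in> words I"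
  by (simp add: words_def)

lemma words_Cons [simp]: "x # w \<in> words I \<longleftrightarrow> fst x \<in> I \<and> w \<in> words I"
  by (cases x) (auto simp: words_def)

lemma words_append [simp]: "u @ v \<in> words I \<longleftrightarrow> u \<in> words I \<and> v \<in> words I"
  by (simp add: words_def)

lemma words_pos [simp]: "pos xs \<in> words I \<longleftrightarrow> set xs \<subseteq> I"
  by (auto simp: words_def pos_def)

lemma signed_prod_pos [simp]: "signed_prod G f (pos xs) = list_prod G f xs"
  by (induction xs) (simp_all add: pos_def)

text \<open>The side conditions are those under which \<open>pres_eq\<close> applies a relation.\<close>

definition satisfies ::
  "('g, 'b) monoid_scheme \<Rightarrow> ('i \<Rightarrow> 'g) \<Rightarrow> 'i set \<Rightarrow> ('i word \<times> 'i word) set \<Rightarrow> bool" where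
  "satisfies G f I R \<longleftrightarrow>
    (\<forall>(u, v)\<in>R. u \<in> words I \<longrightarrow> v \<in> words I \<longrightarrow> signed_prod G f u = signed_prod G f v)"

lemma satisfies_pos:
  "satisfies G f I R \<Longrightarrow> (pos xs, pos ys) \<in> R \<Longrightarrow> set xs \<subseteq> I \<Longrightarrow> set ys \<subseteq> I \<Longrightarrow>
   list_prod G f xs = list_prod G f ys"
  by (fastforce simp: satisfies_def)

context group
begin

lemma list_prod_closed [simp]:
  "(\<And>x. x \<in> set xs \<Longrightarrow> f x \<in> carrier G) \<Longrightarrow> list_prod G f xs \<in> carrier G"
  by (induction xs) auto

lemma list_prod_append:
  "(\<And>x. x \<in> set xs \<union> set ys \<Longrightarrow> f x \<in> carrier G) \<Longrightarrow>
   list_prod G f (xs @ ys) = list_prod G f xs \<otimes> list_prod G f ys"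
  by (induction xs) (auto simp: m_assoc)

lemma signed_prod_closed [simp]:
  "f \<in> I \<rightarrow> carrier G \<Longrightarrow> w \<in> words I \<Longrightarrow> signed_prod G f w \<in> carrier G"
  by (induction w) (auto simp: Pi_iff)

lemma signed_prod_append:
  "f \<in> I \<rightarrow> carrier G \<Longrightarrow> u \<in> words I \<Longrightarrow> v \<in> words I \<Longrightarrow>
   signed_prod G f (u @ v) = signed_prod G f u \<otimes> signed_prod G f v"
proof (induction u)
  case (Cons x u)
  obtain i b where x: "x = (i, b)" by fastforce
  have "f i \<in> carrier G" using Cons.prems x by auto
  with Cons show ?case by (auto simp: x m_assoc)
qed auto

lemma signed_prod_pres_eq:
  assumes f: "f \<in> I \<rightarrow> carrier G"
    and sat: "satisfies G f I R"
    and "pres_eq I R u v"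
  shows "signed_prod G f u = signed_prod G f v"
  using assms(3)
proof induction
  case (append u u' v v')
  then show ?case
    using signed_prod_append[OF f] pres_eq_words by metis
next
  case (cancel i b)
  then have "f i \<in> carrier G" using f by auto
  then show ?case by simp
qed (use sat in \<open>auto simp: satisfies_def\<close>)

text \<open>The universal property of a group given by generators and relations.\<close>

lemma presented_group_universal:
  assumes f: "f \<in> I \<rightarrow> carrier G" and sat: "satisfies G f I R"
  obtains h where "h \<in> hom (presented_group I R) G" "\<And>i. i \<in> I \<Longrightarrow> h (pres_gen I R i) = f i"
proof
  let ?h = "\<lambda>A. signed_prod G f (SOME w. w \<in> A)"
  have h: "?h (pres_class I R w) = signed_prod G f w" if "w \<in> words I" for w
  proof -
    have "pres_eq I R w (SOME v. v \<in> pres_class I R w)"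
      using pres_eq.refl[OF that] by (auto simp: pres_class_def intro: someI)
    from signed_prod_pres_eq[OF f sat this] show ?thesis by simp
  qed
  show "?h \<in> hom (presented_group I R) G"
  proof (rule homI)
    fix A assume "A \<in> carrier (presented_group I R)"
    then show "?h A \<in> carrier G"
      using f h by (auto simp: presented_group_def)
  next
    fix A B assume "A \<in> carrier (presented_group I R)" "B \<in> carrier (presented_group I R)"
    then obtain u v where "u \<in> words I" "A = pres_class I R u" "v \<in> words I" "B = pres_class I R v"
      by (auto simp: presented_group_def)
    then show "?h (A \<otimes>\<^bsub>presented_group I R\<^esub> B) = ?h A \<otimes> ?h B"
      using h f by (simp add: presented_group_mult signed_prod_append)
  qed
  show "?h (pres_gen I R i) = f i" if "i \<in> I" for i
    using h[of "pos [i]"] that f by (auto simp: pres_gen_def Pi_iff)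
qed

end

lemma (in group_hom) hom_signed_prod:
  "f \<in> I \<rightarrow> carrier G \<Longrightarrow> w \<in> words I \<Longrightarrow> h (signed_prod G f w) = signed_prod H (h \<circ> f) w"
  by (induction w) (auto simp: Pi_iff)

lemma pres_gen_closed [simp]: "i \<in> I \<Longrightarrow> pres_gen I R i \<in> carrier (presented_group I R)"
  by (simp add: pres_gen_def presented_group_def)

lemma pres_class_closed [simp]:
  "w \<in> words I \<Longrightarrow> pres_class I R w \<in> carrier (presented_group I R)"
  by (simp add: presented_group_def)

lemma pres_class_signed_prod:
  "w \<in> words I \<Longrightarrow>
   pres_class I R w = signed_prod (presented_group I R) (pres_gen I R) w"
proof (induction w)
  case Nil
  then show ?case by (simp add: presented_group_def)
next
  case (Cons x w)
  let ?P = "presented_group I R"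
  interpret P: group ?P by (rule group_presented_group)
  obtain i b where x: "x = (i, b)" by fastforce
  have i: "i \<in> I" and w: "w \<in> words I" using Cons.prems x by auto
  have "pres_class I R [(i, False)] \<otimes>\<^bsub>?P\<^esub> pres_gen I R i = pres_class I R [(i, False), (i, True)]"
    using presented_group_mult[of "[(i, False)]" I "[(i, True)]" R] i
    by (simp add: pres_gen_def pos_def)
  also have "\<dots> = \<one>\<^bsub>?P\<^esub>"
    using pres_eq.cancel[OF i, of R False] pres_class_eq_iff[of "[(i, False), (i, True)]" I R] i
    by (simp add: presented_group_def)
  finally have "pres_class I R [(i, False)] = inv\<^bsub>?P\<^esub> pres_gen I R i"
    using i by (intro P.inv_equality[symmetric]) simp_all
  then have "pres_class I R [(i, b)] = (if b then pres_gen I R i else inv\<^bsub>?P\<^esub> pres_gen I R i)"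
    by (cases b) (simp_all add: pres_gen_def pos_def)
  moreover have "pres_class I R (x # w) = pres_class I R [(i, b)] \<otimes>\<^bsub>?P\<^esub> pres_class I R w"
    using presented_group_mult[of "[(i, b)]" I w R] i w by (simp add: x)
  ultimately show ?case using Cons.IH[OF w] by (simp add: x)
qed

lemma pres_gen_satisfies: "satisfies (presented_group I R) (pres_gen I R) I R"
  unfolding satisfies_def
  by (auto simp: pres_class_eq_iff pres_eq.relation simp flip: pres_class_signed_prod)

lemma hom_presented_group_cong:
  assumes "group G" and h: "h \<in> hom (presented_group I R) G" and k: "k \<in> hom (presented_group I R) G"
    and eq: "\<And>i. i \<in> I \<Longrightarrow> h (pres_gen I R i) = k (pres_gen I R i)"
    and A: "A \<in> carrier (presented_group I R)"
  shows "h A = k A"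
proof -
  let ?P = "presented_group I R"
  interpret P: group ?P by (rule group_presented_group)
  interpret h: group_hom ?P G h using assms(1) h by (intro group_hom.intro group_hom_axioms.intro P.is_group)
  interpret k: group_hom ?P G k using assms(1) k by (intro group_hom.intro group_hom_axioms.intro P.is_group)
  obtain w where w: "w \<in> words I" "A = pres_class I R w" using A by (auto simp: presented_group_def)
  have gens: "pres_gen I R \<in> I \<rightarrow> carrier ?P" by auto
  have "signed_prod G (h \<circ> pres_gen I R) w = signed_prod G (k \<circ> pres_gen I R) w"
    using w(1) eq by (induction w) auto
  then show ?thesis
    using h.hom_signed_prod[OF gens w(1)] k.hom_signed_prod[OF gens w(1)]
    by (simp add: w pres_class_signed_prod)
qed

text \<open>Mutually inverse homomorphisms need only be checked on generators.\<close>

lemma has_presentation_presented_groupI: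
  assumes f: "f \<in> hom (presented_group I R) (presented_group J Q)"
    and g: "g \<in> hom (presented_group J Q) (presented_group I R)"
    and c: "\<And>i. i \<in> I \<Longrightarrow> f (pres_gen I R i) = c i"
    and gf: "\<And>i. i \<in> I \<Longrightarrow> g (f (pres_gen I R i)) = pres_gen I R i"
    and fg: "\<And>j. j \<in> J \<Longrightarrow> f (g (pres_gen J Q j)) = pres_gen J Q j"
  shows "has_presentation (presented_group J Q) I R c"
proof -
  let ?P = "presented_group I R" and ?C = "presented_group J Q"
  have "(g \<circ> f) A = id A" if "A \<in> carrier ?P" for A
    by (rule hom_presented_group_cong[OF group_presented_group hom_compose[OF f g] _ _ that])
      (simp_all add: gf hom_def Pi_def)
  moreover have "(f \<circ> g) B = id B" if "B \<in> carrier ?C" for B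
    by (rule hom_presented_group_cong[OF group_presented_group hom_compose[OF g f] _ _ that])
      (simp_all add: fg hom_def Pi_def)
  ultimately have "bij_betw f (carrier ?P) (carrier ?C)"
    using f g by (intro bij_betw_byWitness[where f' = g]) (auto simp: hom_def)
  then show ?thesis
    unfolding has_presentation_def using f c group_presented_group by (auto simp: iso_def)
qed

section \<open>Words acting by involutions\<close>

text \<open>Conjugation by the involution \<open>f\<close> inverts \<open>f g\<close>.\<close>

lemma alt_funpow_absorb:
  assumes D: "\<And>x. x \<in> D \<Longrightarrow> f x \<in> D \<and> g x \<in> D \<and> f (f x) = x \<and> g (g x) = x" and "x \<in> D"
  shows "((\<lambda>x. f (g x)) ^^ k) x \<in> D \<and> ((\<lambda>x. f (g x)) ^^ k) (f (((\<lambda>x. f (g x)) ^^ k) x)) = f x"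
proof (induction k)
  case (Suc k)
  let ?y = "((\<lambda>x. f (g x)) ^^ k) x"
  have right: "((\<lambda>x. f (g x)) ^^ Suc k) z = ((\<lambda>x. f (g x)) ^^ k) (f (g z))" for z
    by (simp add: funpow_Suc_right del: funpow.simps)
  have left: "((\<lambda>x. f (g x)) ^^ Suc k) x = f (g ?y)" by simp
  have "((\<lambda>x. f (g x)) ^^ Suc k) (f (((\<lambda>x. f (g x)) ^^ Suc k) x)) = ((\<lambda>x. f (g x)) ^^ k) (f (g (f (f (g ?y)))))"
    by (simp only: left) (simp only: right)
  also have "\<dots> = ((\<lambda>x. f (g x)) ^^ k) (f ?y)"
    using D Suc.IH by (simp only:)
  also have "\<dots> = f x"
    using Suc.IH by (simp only:)
  finally show ?case using D Suc.IH by simp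
qed (use assms in simp)

text \<open>
  This is used both ways: a trivial rotation \<open>(s t)\<^sup>k\<close> makes an action respect the braid
  relation, and the braid relation in \<open>W\<close>, which acts freely on itself, makes the rotation
  trivial.
\<close>

lemma foldr_alt_prod:
  assumes D: "\<And>x. x \<in> D \<Longrightarrow> F s x \<in> D \<and> F t x \<in> D \<and> F s (F s x) = x \<and> F t (F t x) = x"
    and x: "x \<in> D"
  shows "foldr F (alt_prod t s k) x \<in> D \<and>
    foldr F (alt_prod s t k) x = ((\<lambda>x. F s (F t x)) ^^ k) (foldr F (alt_prod t s k) x)"
proof (induction k)
  case (Suc k)
  let ?y = "foldr F (alt_prod t s k) x" and ?z = "foldr F (alt_prod s t k) x"
  define h where "h = (\<lambda>x. F s (F t x))"
  have right: "(h ^^ Suc k) z = (h ^^ k) (F s (F t z))" for z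
    by (simp add: funpow_Suc_right h_def del: funpow.simps)
  have y: "?y \<in> D" and z: "?z = (h ^^ k) ?y" using Suc.IH unfolding h_def by blast+
  have absorb: "(h ^^ k) ?y \<in> D" "(h ^^ k) (F s ((h ^^ k) ?y)) = F s ?y"
    using alt_funpow_absorb[of D "F s" "F t" ?y k] D y unfolding h_def by blast+
  have "(h ^^ Suc k) (F t ?z) = F s ?y"
    using D absorb by (simp only: right z)
  then show ?case using D y z absorb(1) by (simp add: h_def)
qed (use x in simp)

text \<open>
  Actions of a Coxeter group can be prescribed on generators: since these act by involutions,
  inverse letters may be read as letters, and a braid relation becomes the triviality of a
  power.
\<close>

lemma involution_action_pres_eq:
  assumes D: "\<And>s x. s \<in> S \<Longrightarrow> x \<in> D \<Longrightarrow> F s x \<in> D \<and> F s (F s x) = x"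
    and braid: "\<And>s t n x. s \<in> S \<Longrightarrow> t \<in> S \<Longrightarrow> s \<noteq> t \<Longrightarrow> m s t = enat n \<Longrightarrow> x \<in> D \<Longrightarrow>
      ((\<lambda>x. F s (F t x)) ^^ n) x = x"
    and "pres_eq S (coxeter_relations S m) u v" and "x \<in> D"
  shows "foldr F (map fst u) x = foldr F (map fst v) x"
  using assms(3,4)
proof (induction arbitrary: x)
  have foldr_D: "foldr F (map fst w) x \<in> D" if "w \<in> words S" "x \<in> D" for w :: "'a word" and x
    using that D by (induction w) auto
  case (append u u' v v')
  then have "foldr F (map fst v) x = foldr F (map fst v') x" and "foldr F (map fst v') x \<in> D"
    using foldr_D pres_eq_words by blast+
  with append.IH(1) show ?case by simp
next
  case (relation u v)
  have *: "map fst (pos xs) = xs" for xs :: "'a list" by (simp add: pos_def comp_def)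
  from relation.hyps(1) consider s where "s \<in> S" "u = pos [s, s]" "v = pos []"
    | s t n where "s \<in> S" "t \<in> S" "s \<noteq> t" "m s t = enat n"
        "u = pos (alt_prod t s n)" "v = pos (alt_prod s t n)"
    unfolding coxeter_relations_def by (auto simp: pos_def)
  then show ?case
  proof cases
    case 1
    then show ?thesis using D relation.prems by (simp add: *)
  next
    case 2
    then show ?thesis
      using foldr_alt_prod[of D F s t x n] D braid[OF 2(1-4)] relation.prems by (simp add: *)
  qed
qed (use D in auto)

lemma (in group) conj_eq_iff:
  assumes "g \<in> carrier G" "x \<in> carrier G" "y \<in> carrier G"
  shows "g \<otimes> x \<otimes> inv g = y \<longleftrightarrow> x = inv g \<otimes> y \<otimes> g"
proof
  assume "g \<otimes> x \<otimes> inv g = y"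
  then have "inv g \<otimes> y \<otimes> g = inv g \<otimes> (g \<otimes> x \<otimes> inv g) \<otimes> g" by simp
  also have "\<dots> = x" using assms by (simp add: m_assoc inv_solve_left')
  finally show "x = inv g \<otimes> y \<otimes> g" by simp
next
  assume "x = inv g \<otimes> y \<otimes> g"
  then have "g \<otimes> x \<otimes> inv g = g \<otimes> (inv g \<otimes> y \<otimes> g) \<otimes> inv g" by simp
  also have "\<dots> = g \<otimes> inv g \<otimes> y \<otimes> (g \<otimes> inv g)"
    using assms by (simp only: m_assoc inv_closed m_closed)
  also have "\<dots> = y" using assms by simp
  finally show "g \<otimes> x \<otimes> inv g = y" .
qed

section \<open>Elementary facts on Coxeter systems\<close>

locale coxeter = group W for W (structure) +
  fixes S :: "'a set" and m :: "'a \<Rightarrow> 'a \<Rightarrow> enat"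
  assumes coxeter_system: "coxeter_system W S m"
begin

abbreviation prd :: "'a list \<Rightarrow> 'a" where
  "prd \<equiv> list_prod W (\<lambda>s. s)"

lemma gens_closed: "s \<in> S \<Longrightarrow> s \<in> carrier W"
  using coxeter_system by (auto simp: coxeter_system_def)

lemma finite_S: "finite S"
  and m_diag: "s \<in> S \<Longrightarrow> m s s = 1"
  and m_sym: "s \<in> S \<Longrightarrow> t \<in> S \<Longrightarrow> m s t = m t s"
  and m_ge_2: "s \<in> S \<Longrightarrow> t \<in> S \<Longrightarrow> s \<noteq> t \<Longrightarrow> 2 \<le> m s t"
  using coxeter_system by (auto simp: coxeter_system_def coxeter_matrix_def)

lemma prd_closed: "set xs \<subseteq> S \<Longrightarrow> prd xs \<in> carrier W"
  using gens_closed by (intro list_prod_closed) auto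

text \<open>
  The only access to the definition of \<open>W\<close> as a presented group: equality in \<open>W\<close> of two products
  of generators is provable from the Coxeter relations, hence respected by every action as
  above.
\<close>

lemma prd_eq_iff:
  assumes "set xs \<subseteq> S" "set ys \<subseteq> S"
  shows "prd xs = prd ys \<longleftrightarrow> pres_eq S (coxeter_relations S m) (pos xs) (pos ys)"
proof -
  let ?R = "coxeter_relations S m"
  obtain \<phi> where \<phi>: "\<phi> \<in> iso (presented_group S ?R) W" "\<And>s. s \<in> S \<Longrightarrow> \<phi> (pres_gen S ?R s) = s"
    using coxeter_system unfolding coxeter_system_def has_presentation_def by auto
  then interpret \<phi>: group_hom "presented_group S ?R" W \<phi>
    by (intro group_hom.intro group_hom_axioms.intro group_presented_group is_group)
      (auto simp: iso_def)
  have prd: "\<phi> (pres_class S ?R (pos zs)) = prd zs" if "set zs \<subseteq> S" for zs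
    using that unfolding pres_class_signed_prod[OF words_pos[THEN iffD2, OF that]] signed_prod_pos
  proof (induction zs)
    case (Cons z zs)
    have "list_prod (presented_group S ?R) (pres_gen S ?R) zs \<in> carrier (presented_group S ?R)"
      using Cons.prems by (intro group.list_prod_closed[OF group_presented_group]) auto
    with Cons \<phi>(2) show ?case by simp
  qed simp
  have "inj_on \<phi> (carrier (presented_group S ?R))"
    using \<phi>(1) by (auto simp: iso_def bij_betw_def)
  then have "prd xs = prd ys \<longleftrightarrow> pres_class S ?R (pos xs) = pres_class S ?R (pos ys)"
    using assms by (simp add: inj_on_eq_iff flip: prd)
  then show ?thesis using assms by (simp add: pres_class_eq_iff)
qed

lemma prd_relation:
  "(pos xs, pos ys) \<in> coxeter_relations S m \<Longrightarrow> set xs \<subseteq> S \<Longrightarrow> set ys \<subseteq> S \<Longrightarrow> prd xs = prd ys"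
  by (simp add: prd_eq_iff pres_eq.relation)

lemma gen_sq: "s \<in> S \<Longrightarrow> s \<otimes> s = \<one>"
proof -
  assume s: "s \<in> S"
  then have "(pos [s, s], pos []) \<in> coxeter_relations S m"
    by (auto simp: coxeter_relations_def pos_def)
  from prd_relation[OF this] s show ?thesis by (simp add: gens_closed)
qed

lemma gen_inv: "s \<in> S \<Longrightarrow> inv s = s"
  by (rule inv_equality) (auto simp: gen_sq gens_closed)

lemma gen_cancel: "s \<in> S \<Longrightarrow> x \<in> carrier W \<Longrightarrow> s \<otimes> (s \<otimes> x) = x"
  by (simp add: gens_closed gen_sq flip: m_assoc)

lemma set_alt_prod: "set (alt_prod s t n) \<subseteq> {s, t}"
  by (induction s t n rule: alt_prod.induct) auto

lemma gen_mult_pow: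
  assumes s: "s \<in> S" and t: "t \<in> S" and "s \<noteq> t" "m s t = enat n"
  shows "(s \<otimes> t) [^] n = \<one>"
proof -
  let ?F = "\<lambda>s x. s \<otimes> x"
  have "(pos (alt_prod t s n), pos (alt_prod s t n)) \<in> coxeter_relations S m"
    using assms by (auto simp: coxeter_relations_def)
  with s t set_alt_prod have eq: "prd (alt_prod t s n) = prd (alt_prod s t n)"
    by (intro prd_relation) fastforce+
  have pow: "((\<lambda>x. ?F s (?F t x)) ^^ k) z = (s \<otimes> t) [^] k \<otimes> z" if "z \<in> carrier W" for k z
    using that
  proof (induction k arbitrary: z)
    case (Suc k)
    then show ?case
      using s t by (simp add: funpow_Suc_right gens_closed m_assoc del: funpow.simps)
  qed simp
  have "prd (alt_prod s t n) = ((\<lambda>x. ?F s (?F t x)) ^^ n) (prd (alt_prod t s n))"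
    using foldr_alt_prod[of "carrier W" ?F s t \<one> n] s t
    by (simp add: list_prod_def gens_closed gen_cancel)
  also have "\<dots> = (s \<otimes> t) [^] n \<otimes> prd (alt_prod t s n)"
    using s t set_alt_prod[of t s n] by (intro pow prd_closed) auto
  finally have "(s \<otimes> t) [^] n \<otimes> prd (alt_prod t s n) = prd (alt_prod t s n)"
    using eq by simp
  moreover have "prd (alt_prod t s n) \<in> carrier W"
    using s t set_alt_prod[of t s n] by (intro prd_closed) auto
  ultimately show ?thesis using s t
    by (simp add: gens_closed r_cancel_one')
qed

end

section \<open>Inversions, exchange and parabolic subgroups\<close>

text \<open>
  Counting modulo \<open>2\<close> by recursion makes the cancellation over two periods a matter of
  propositional logic.
\<close>

fun parity :: "(nat \<Rightarrow> bool) \<Rightarrow> nat \<Rightarrow> bool" where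
  "parity P 0 = False"
| "parity P (Suc n) = (parity P n \<noteq> P n)"

lemma parity_add: "parity P (k + n) = (parity P k \<noteq> parity (\<lambda>j. P (k + j)) n)"
  by (induction n) auto

lemma parity_periodic: "(\<And>j. P (n + j) = P j) \<Longrightarrow> parity P (n + n) = False"
  by (simp add: parity_add)

context coxeter
begin

text \<open>
  The pairs model the roots, the tag being the sign: a generator changes the sign of no root but
  its own one and the negative of that.
\<close>

definition refl_act :: "'a \<Rightarrow> 'a \<times> bool \<Rightarrow> 'a \<times> bool" where
  "refl_act s = (\<lambda>(r, e). (s \<otimes> r \<otimes> s, e \<noteq> (r = s)))"

text \<open>
  While \<open>(s t)\<^sup>k\<close> acts, the tag of \<open>r\<close> flips once for every \<open>j < 2 k\<close> such that \<open>r = (t s)\<^sup>j t\<close>.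
  If \<open>(t s)\<^sup>k = 1\<close> this condition has period \<open>k\<close> in \<open>j\<close>, so the flips cancel in pairs, whatever
  the actual order of \<open>t s\<close> is.
\<close>

lemma refl_act_dihedral:
  assumes s: "s \<in> S" and t: "t \<in> S" and r: "r \<in> carrier W"
  shows "((\<lambda>x. refl_act s (refl_act t x)) ^^ k) (r, e) =
    ((s \<otimes> t) [^] k \<otimes> r \<otimes> (t \<otimes> s) [^] k, e \<noteq> parity (\<lambda>j. r = (t \<otimes> s) [^] j \<otimes> t) (2 * k))"
proof (induction k)
  case 0
  then show ?case using r by simp
next
  case (Suc k)
  let ?a = "s \<otimes> t" and ?b = "t \<otimes> s"
  have c [simp]: "s \<in> carrier W" "t \<in> carrier W" "r \<in> carrier W"
    using s t r by (auto intro: gens_closed)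
  have inv_a: "inv ?a = ?b" using s t by (simp add: inv_mult_group gen_inv)
  have ta: "t \<otimes> ?a [^] j = ?b [^] j \<otimes> t" for j :: nat
  proof (induction j)
    case (Suc j)
    have "t \<otimes> ?a [^] Suc j = (t \<otimes> ?a [^] j) \<otimes> ?a" by (simp add: m_assoc)
    also have "\<dots> = ?b [^] Suc j \<otimes> t" by (simp add: Suc.IH m_assoc)
    finally show ?case .
  qed simp
  define A where "A = ?a [^] k"
  define B where "B = ?b [^] k"
  have [simp]: "A \<in> carrier W" "B \<in> carrier W" by (simp_all add: A_def B_def)
  have AB: "inv A = B" by (simp add: A_def B_def nat_pow_inv inv_a flip: inv_a)
  have conj: "A \<otimes> r \<otimes> B = u \<longleftrightarrow> r = B \<otimes> u \<otimes> A" if "u \<in> carrier W" for u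
    using conj_eq_iff[of A r u] that by (simp add: AB)
  have tA: "t \<otimes> A = B \<otimes> t" using ta by (simp add: A_def B_def)
  have BB: "B \<otimes> B = ?b [^] (2 * k)" by (simp add: B_def nat_pow_mult mult_2)
  have 1: "A \<otimes> r \<otimes> B = t \<longleftrightarrow> r = ?b [^] (2 * k) \<otimes> t"
    using conj[of t] tA BB by (simp add: m_assoc flip: BB)
  have "t \<otimes> (A \<otimes> r \<otimes> B) \<otimes> t = s \<longleftrightarrow> A \<otimes> r \<otimes> B = t \<otimes> s \<otimes> t"
    using conj_eq_iff[of t "A \<otimes> r \<otimes> B" s] t by (simp add: gen_inv)
  also have "\<dots> \<longleftrightarrow> r = B \<otimes> (t \<otimes> s \<otimes> t) \<otimes> A" by (intro conj) simp
  also have "B \<otimes> (t \<otimes> s \<otimes> t) \<otimes> A = B \<otimes> (?b \<otimes> B) \<otimes> t" by (simp add: m_assoc tA)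
  also have "?b \<otimes> B = B \<otimes> ?b"
    by (simp add: B_def flip: nat_pow_Suc2)
  also have "B \<otimes> (B \<otimes> ?b) = ?b [^] Suc (2 * k)"
    by (simp add: BB flip: m_assoc)
  finally have 2: "t \<otimes> (A \<otimes> r \<otimes> B) \<otimes> t = s \<longleftrightarrow> r = ?b [^] Suc (2 * k) \<otimes> t" .
  have 3: "s \<otimes> (t \<otimes> (A \<otimes> r \<otimes> B) \<otimes> t) \<otimes> s = ?a [^] Suc k \<otimes> r \<otimes> ?b [^] Suc k"
  proof -
    have "?a [^] Suc k = ?a \<otimes> A" by (metis A_def c(1,2) m_closed nat_pow_Suc2)
    then show ?thesis by (simp add: m_assoc B_def)
  qed
  have "((\<lambda>x. refl_act s (refl_act t x)) ^^ Suc k) (r, e)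
      = refl_act s (refl_act t (A \<otimes> r \<otimes> B, e \<noteq> parity (\<lambda>j. r = ?b [^] j \<otimes> t) (2 * k)))"
    by (simp add: Suc.IH A_def B_def)
  also have "\<dots> = (?a [^] Suc k \<otimes> r \<otimes> ?b [^] Suc k, e \<noteq> parity (\<lambda>j. r = ?b [^] j \<otimes> t) (2 * Suc k))"
    by (simp add: refl_act_def 1 2 3 del: nat_pow_Suc) blast
  finally show ?case .
qed

lemma refl_act_pres_eq:
  assumes "pres_eq S (coxeter_relations S m) u v" "r \<in> carrier W"
  shows "foldr refl_act (map fst u) (r, e) = foldr refl_act (map fst v) (r, e)"
proof (rule involution_action_pres_eq[where D = "carrier W \<times> UNIV" and F = refl_act, OF _ _ assms(1)])
  fix s x assume s: "s \<in> S" and x: "x \<in> carrier W \<times> (UNIV :: bool set)"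
  obtain r e where [simp]: "x = (r, e)" "r \<in> carrier W" using x by auto
  have [simp]: "s \<in> carrier W" using s by (rule gens_closed)
  have "s \<otimes> r \<otimes> s = s \<longleftrightarrow> r = s"
    using conj_eq_iff[of s r s] s by (simp add: gen_inv gen_sq)
  moreover have "s \<otimes> (s \<otimes> r \<otimes> s) \<otimes> s = r"
    using s by (simp add: m_assoc gen_sq gen_cancel)
  ultimately show "refl_act s x \<in> carrier W \<times> UNIV \<and> refl_act s (refl_act s x) = x"
    by (auto simp: refl_act_def)
next
  fix s t n x assume st: "s \<in> S" "t \<in> S" "s \<noteq> t" "m s t = enat n"
    and x: "x \<in> carrier W \<times> (UNIV :: bool set)"
  obtain r e where [simp]: "x = (r, e)" "r \<in> carrier W" using x by auto
  have [simp]: "s \<in> carrier W" "t \<in> carrier W" using st by (auto intro: gens_closed)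
  have a: "(s \<otimes> t) [^] n = \<one>" and b: "(t \<otimes> s) [^] n = \<one>"
    using st gen_mult_pow m_sym by metis+
  have "parity (\<lambda>j. r = (t \<otimes> s) [^] j \<otimes> t) (n + n) = False"
    by (rule parity_periodic) (simp add: b flip: nat_pow_mult)
  then show "((\<lambda>x. refl_act s (refl_act t x)) ^^ n) x = x"
    using refl_act_dihedral[OF st(1,2), of r n e] by (simp add: a b mult_2)
qed (use assms(2) in simp)

lemma foldr_refl_act:
  assumes "set xs \<subseteq> S" "r \<in> carrier W"
  shows "foldr refl_act xs (r, e) =
    (prd xs \<otimes> r \<otimes> inv (prd xs), e \<noteq> snd (foldr refl_act xs (r, False)))"
  using assms(1)
proof (induction xs arbitrary: e)
  case (Cons x xs)
  have [simp]: "x \<in> carrier W" "prd xs \<in> carrier W"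
    using Cons.prems by (auto intro: gens_closed prd_closed)
  define e0 where "e0 = snd (foldr refl_act xs (r, False))"
  have "foldr refl_act xs (r, e') = (prd xs \<otimes> r \<otimes> inv (prd xs), e' \<noteq> e0)" for e'
    unfolding e0_def using Cons.prems by (intro Cons.IH) simp
  then show ?case
    using Cons.prems assms(2)
    by (simp add: refl_act_def[of x] m_assoc inv_mult_group gen_inv) blast
qed (use assms in simp)

end

context coxeter
begin

text \<open>
  For a reflection \<open>r\<close> this says that \<open>w r\<close> is shorter than \<open>w\<close>; in terms of roots, that \<open>w\<close>
  makes the root of \<open>r\<close> negative.
\<close>

definition inversions :: "'a \<Rightarrow> 'a set" where
  "inversions w =
    {r \<in> carrier W. \<exists>xs. set xs \<subseteq> S \<and> prd xs = w \<and> snd (foldr refl_act xs (r, False))}"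

lemma inversions_prd:
  assumes "set xs \<subseteq> S" "r \<in> carrier W"
  shows "r \<in> inversions (prd xs) \<longleftrightarrow> snd (foldr refl_act xs (r, False))"
proof -
  have [simp]: "map fst (pos zs) = zs" for zs :: "'a list" by (simp add: pos_def comp_def)
  have "snd (foldr refl_act ys (r, False)) \<longleftrightarrow> snd (foldr refl_act xs (r, False))"
    if "set ys \<subseteq> S" "prd ys = prd xs" for ys
    using refl_act_pres_eq[of "pos ys" "pos xs" r False] that assms prd_eq_iff by simp
  then show ?thesis using assms unfolding inversions_def mem_Collect_eq by blast
qed

lemma generate_eq_prd:
  assumes "I \<subseteq> S"
  shows "generate W I = prd ` {xs. set xs \<subseteq> I}"
proof (rule equalityI; rule subsetI)
  fix w assume "w \<in> generate W I"
  then show "w \<in> prd ` {xs. set xs \<subseteq> I}"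
  proof induction
    case one
    then show ?case by (intro image_eqI[of _ _ "[]"]) auto
  next
    case (incl h)
    then show ?case using assms gens_closed by (intro image_eqI[of _ _ "[h]"]) auto
  next
    case (inv h)
    then show ?case using assms gens_closed gen_inv by (intro image_eqI[of _ _ "[h]"]) auto
  next
    case (eng u v)
    then obtain xs ys where "set xs \<subseteq> I" "u = prd xs" "set ys \<subseteq> I" "v = prd ys" by auto
    moreover from this have "prd (xs @ ys) = prd xs \<otimes> prd ys"
      using assms gens_closed by (intro list_prod_append) auto
    ultimately show ?case by (intro image_eqI[of _ _ "xs @ ys"]) auto
  qed
next
  fix w assume "w \<in> prd ` {xs. set xs \<subseteq> I}"
  then obtain xs where "set xs \<subseteq> I" "w = prd xs" by auto
  then show "w \<in> generate W I"
    by (induction xs arbitrary: w) (auto intro: generate.intros)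
qed

lemma generate_closed: "I \<subseteq> S \<Longrightarrow> w \<in> generate W I \<Longrightarrow> w \<in> carrier W"
  using generate_in_carrier[of I w] gens_closed by auto

lemma generate_S: "I \<subseteq> S \<Longrightarrow> w \<in> generate W I \<Longrightarrow> w \<in> generate W S"
  using mono_generate by auto

lemma generate_inv: "I \<subseteq> S \<Longrightarrow> w \<in> generate W I \<Longrightarrow> inv w \<in> generate W I"
  using generate_m_inv_closed[of I w] gens_closed by auto

lemma inversions_closed: "r \<in> inversions w \<Longrightarrow> r \<in> carrier W"
  by (simp add: inversions_def)

lemma inversions_one [simp]: "inversions \<one> = {}"
  using inversions_prd[of "[]"] inversions_closed by auto

lemma inversions_gen: "s \<in> S \<Longrightarrow> inversions s = {s}"
  using inversions_prd[of "[s]"] inversions_closed[of _ s] gens_closed[of s]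
  by (auto simp: refl_act_def)

lemma inversions_mult:
  assumes "u \<in> generate W S" "v \<in> generate W S" "r \<in> carrier W"
  shows "r \<in> inversions (u \<otimes> v) \<longleftrightarrow> (r \<in> inversions v) \<noteq> (v \<otimes> r \<otimes> inv v \<in> inversions u)"
proof -
  obtain xs ys where xs: "set xs \<subseteq> S" "u = prd xs" and ys: "set ys \<subseteq> S" "v = prd ys"
    using assms by (auto simp: generate_eq_prd)
  have c: "prd ys \<in> carrier W" using ys(1) by (rule prd_closed)
  then have q: "prd ys \<otimes> r \<otimes> inv (prd ys) \<in> carrier W" using assms(3) by simp
  define e where "e = snd (foldr refl_act ys (r, False))"
  have "fst (foldr refl_act ys (r, False)) = prd ys \<otimes> r \<otimes> inv (prd ys)"
    by (subst foldr_refl_act[OF ys(1) assms(3)]) simp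
  then have inner: "foldr refl_act ys (r, False) = (prd ys \<otimes> r \<otimes> inv (prd ys), e)"
    by (simp add: e_def prod_eq_iff)
  have outer: "snd (foldr refl_act xs (prd ys \<otimes> r \<otimes> inv (prd ys), e)) \<longleftrightarrow>
      e \<noteq> (prd ys \<otimes> r \<otimes> inv (prd ys) \<in> inversions (prd xs))"
    unfolding inversions_prd[OF xs(1) q] by (subst foldr_refl_act[OF xs(1) q]) simp
  have "prd (xs @ ys) = prd xs \<otimes> prd ys"
    using xs ys gens_closed by (intro list_prod_append) auto
  moreover have "r \<in> inversions (prd (xs @ ys)) \<longleftrightarrow>
      e \<noteq> (prd ys \<otimes> r \<otimes> inv (prd ys) \<in> inversions (prd xs))"
    using inversions_prd[of "xs @ ys" r] xs ys assms(3) by (simp add: inner outer)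
  moreover have "r \<in> inversions (prd ys) \<longleftrightarrow> e"
    unfolding e_def using ys(1) assms(3) by (rule inversions_prd)
  ultimately show ?thesis by (simp add: xs(2) ys(2))
qed

lemma inversions_mult_gen:
  assumes "u \<in> generate W S" "s \<in> S" "r \<in> carrier W"
  shows "r \<in> inversions (u \<otimes> s) \<longleftrightarrow> (r = s) \<noteq> (s \<otimes> r \<otimes> s \<in> inversions u)"
  using inversions_mult[of u s r] assms by (simp add: generate.incl inversions_gen gen_inv)

text \<open>
  The strong exchange condition: an inversion of a word arises at some letter, and
  multiplication by it deletes that letter. The result is again a word over \<open>I\<close>, which is why
  lengths can be measured inside any parabolic subgroup.
\<close>

lemma exchange:
  assumes "I \<subseteq> S" "set xs \<subseteq> I" "r \<in> inversions (prd xs)"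
  obtains ys where "set ys \<subseteq> I" "length ys < length xs" "prd xs \<otimes> r = prd ys"
proof -
  have r: "r \<in> carrier W" using assms(3) by (rule inversions_closed)
  have "\<exists>ys. set ys \<subseteq> I \<and> length ys < length xs \<and> prd xs \<otimes> r = prd ys"
    using assms(2,3)
  proof (induction xs)
    case (Cons x xs)
    have c: "x \<in> S" "x \<in> carrier W" "prd xs \<in> carrier W"
      using Cons.prems assms(1) by (auto intro: gens_closed prd_closed)
    have xsI: "set xs \<subseteq> I" using Cons.prems by simp
    have gen: "prd xs \<in> generate W S" using xsI assms(1) by (auto simp: generate_eq_prd)
    show ?case
    proof (cases "r \<in> inversions (prd xs)")
      case True
      then obtain ys where "set ys \<subseteq> I" "length ys < length xs" "prd xs \<otimes> r = prd ys"
        using Cons.IH xsI by auto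
      then show ?thesis
        using c r Cons.prems(1) by (intro exI[of _ "x # ys"]) (auto simp: m_assoc)
    next
      case False
      then have "prd xs \<otimes> r \<otimes> inv (prd xs) = x"
        using Cons.prems(2) inversions_mult[of x "prd xs" r] c r gen
        by (simp add: inversions_gen generate.incl)
      then have "prd xs \<otimes> r = x \<otimes> prd xs"
        using c r inv_solve_right'[of x "prd xs \<otimes> r" "prd xs"] by simp
      then show ?thesis
        using c r xsI by (intro exI[of _ xs]) (simp add: m_assoc gen_cancel)
    qed
  qed simp
  with that show ?thesis by blast
qed

definition word_len :: "'a set \<Rightarrow> 'a \<Rightarrow> nat" where
  "word_len I w = (LEAST n. \<exists>xs. set xs \<subseteq> I \<and> length xs = n \<and> prd xs = w)"

lemma reduced_word:
  assumes "I \<subseteq> S" "w \<in> generate W I"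
  obtains xs where "set xs \<subseteq> I" "length xs = word_len I w" "prd xs = w"
proof -
  have "\<exists>n xs. set xs \<subseteq> I \<and> length xs = n \<and> prd xs = w"
    using assms by (auto simp: generate_eq_prd)
  from LeastI_ex[OF this] that show ?thesis by (auto simp: word_len_def)
qed

lemma word_len_le: "set xs \<subseteq> I \<Longrightarrow> prd xs = w \<Longrightarrow> word_len I w \<le> length xs"
  unfolding word_len_def by (rule Least_le) auto

lemma word_len_inversion:
  assumes "I \<subseteq> S" "w \<in> generate W I" "r \<in> inversions w"
  shows "word_len I (w \<otimes> r) < word_len I w"
proof -
  obtain xs where xs: "set xs \<subseteq> I" "length xs = word_len I w" "prd xs = w"
    using reduced_word assms(1,2) by blast
  with assms exchange[of I xs r] obtain ys
    where "set ys \<subseteq> I" "length ys < length xs" "prd xs \<otimes> r = prd ys" by metis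
  with word_len_le[of ys I "w \<otimes> r"] xs show ?thesis by simp
qed

text \<open>
  The last letter of a reduced word is an inversion: otherwise it would be an inversion of the
  remaining word, which could then be shortened by the exchange condition.
\<close>

lemma descent:
  assumes I: "I \<subseteq> S" and w: "w \<in> generate W I" and "w \<noteq> \<one>"
  obtains s where "s \<in> I" "s \<in> inversions w"
proof -
  obtain xs where xs: "set xs \<subseteq> I" "length xs = word_len I w" "prd xs = w"
    using reduced_word I w by blast
  with \<open>w \<noteq> \<one>\<close> have "xs \<noteq> []" by auto
  then obtain ys s where ys: "xs = ys @ [s]" by (metis rev_exhaust)
  have s: "s \<in> I" "s \<in> S" "s \<in> carrier W" and ysI: "set ys \<subseteq> I"
    using xs ys I gens_closed by auto
  have c: "prd ys \<in> generate W S" using ysI I by (auto simp: generate_eq_prd)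
  have "prd (ys @ [s]) = prd ys \<otimes> prd [s]"
    using ysI s I gens_closed by (intro list_prod_append) auto
  then have w_eq: "w = prd ys \<otimes> s" using s xs ys by simp
  have "s \<in> inversions w"
  proof (rule ccontr)
    assume "s \<notin> inversions w"
    then have "s \<in> inversions (prd ys)"
      using inversions_mult_gen[OF c s(2,3)] s by (simp add: w_eq gen_sq)
    with exchange[of I ys s] I ysI obtain zs
      where "set zs \<subseteq> I" "length zs < length ys" "prd ys \<otimes> s = prd zs" by metis
    with word_len_le[of zs I w] xs ys w_eq show False by simp
  qed
  with s(1) that show ?thesis by blast
qed

lemma inversions_generate:
  assumes I: "I \<subseteq> S" and w: "w \<in> generate W I"
  shows "inversions w \<subseteq> generate W I"
proof
  fix r assume r: "r \<in> inversions w"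
  obtain xs where xs: "set xs \<subseteq> I" "w = prd xs" using w I by (auto simp: generate_eq_prd)
  with exchange[of I xs r] I r obtain ys where "set ys \<subseteq> I" "w \<otimes> r = prd ys" by metis
  then have "w \<otimes> r \<in> generate W I" using I by (auto simp: generate_eq_prd)
  then have "inv w \<otimes> (w \<otimes> r) \<in> generate W I" using generate_inv[OF I w] by (rule generate.eng[rotated])
  then show "r \<in> generate W I"
    using inversions_closed[OF r] generate_closed[OF I w] by (simp flip: m_assoc)
qed

text \<open>
  If \<open>q\<close> is shortest in its coset \<open>p W\<^sub>J\<close>, then \<open>q\<close> has no inversion in \<open>W\<^sub>J\<close>. Writing
  \<open>p = q b\<close>, the inversions of \<open>p\<close> in \<open>W\<^sub>J\<close> are those of \<open>b\<close>, and if there is no simple one then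
  \<open>b = 1\<close>.
\<close>

lemma parabolic_inversions:
  assumes J: "J \<subseteq> S" and p: "p \<in> generate W S" and disj: "inversions p \<inter> J = {}"
  shows "inversions p \<inter> generate W J = {}"
proof -
  define C where "C = (\<lambda>a. p \<otimes> a) ` generate W J"
  have "p \<in> carrier W" using p generate_closed by blast
  then have "p \<in> C" unfolding C_def using generate.one[of W J] by (intro image_eqI[of _ _ \<one>]) auto
  then obtain q where q: "q \<in> C" and min: "\<And>q'. q' \<in> C \<Longrightarrow> word_len S q \<le> word_len S q'"
    using ex_has_least_nat[of "\<lambda>q. q \<in> C" p "word_len S"] by auto
  obtain b where b: "b \<in> generate W J" "q = p \<otimes> b" using q by (auto simp: C_def)
  have qS: "q \<in> generate W S" using b p generate_S[OF J] by (auto intro: generate.eng)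
  have q_inv: "r \<notin> inversions q" if "r \<in> generate W J" for r
  proof
    assume "r \<in> inversions q"
    then have "word_len S (q \<otimes> r) < word_len S q" using qS by (intro word_len_inversion) auto
    moreover have "q \<otimes> r = p \<otimes> (b \<otimes> r)"
      using b that generate_closed[OF J] \<open>p \<in> carrier W\<close> by (simp add: m_assoc)
    then have "q \<otimes> r \<in> C" using b that by (auto simp: C_def intro: generate.eng)
    ultimately show False using min[of "q \<otimes> r"] by simp
  qed
  have binv: "inv b \<in> generate W J" using generate_inv[OF J b(1)] .
  have p_eq: "p = q \<otimes> inv b"
    using b generate_closed[OF J b(1)] \<open>p \<in> carrier W\<close> by (simp add: m_assoc)
  have "inv b = \<one>"
  proof (rule ccontr)
    assume "inv b \<noteq> \<one>"
    then obtain s where s: "s \<in> J" "s \<in> inversions (inv b)" using descent[OF J binv] by blast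
    have "inv b \<otimes> s \<otimes> inv (inv b) \<in> generate W J"
      using s binv generate_inv[OF J binv] by (auto intro: generate.eng generate.incl)
    then have "s \<in> inversions p"
      using s q_inv inversions_mult[of q "inv b" s] qS generate_S[OF J binv] J gens_closed
      by (auto simp: p_eq)
    with s disj show False by auto
  qed
  with p_eq qS have "p = q" using generate_closed[of S q] by simp
  with q_inv show ?thesis by auto
qed

end

section \<open>The geometric representation\<close>

text \<open>
  The recurrence has the closed solution \<open>y k sin \<theta> = y 1 sin (k \<theta>) - y 0 sin ((k - 1) \<theta>)\<close>,
  which is \<open>n\<close>-periodic; summing the recurrence over a period gives
  \<open>(2 - 2 cos \<theta>) (\<Sum>k<n. y k) = 0\<close>.
\<close>

lemma recurrence_periodic:
  fixes y :: "nat \<Rightarrow> real" and n :: nat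
  defines "\<theta> \<equiv> 2 * pi / n"
  assumes n: "3 \<le> n" and rec: "\<And>k. y (Suc (Suc k)) = 2 * cos \<theta> * y (Suc k) - y k"
  shows "(\<Sum>k<n. y k) = 0"
proof -
  have "0 < \<theta>" "\<theta> < pi" using n by (auto simp: \<theta>_def field_simps)
  then have sin: "sin \<theta> > 0" by (rule sin_gt_zero)
  have "cos \<theta> \<noteq> 1" using sin sin_squared_eq[of \<theta>] by auto
  have closed: "sin \<theta> * y k = y 1 * sin (k * \<theta>) - y 0 * sin (k * \<theta> - \<theta>) \<and>
    sin \<theta> * y (Suc k) = y 1 * sin (k * \<theta> + \<theta>) - y 0 * sin (k * \<theta>)" for k
  proof (induction k)
    case (Suc k)
    have step: "sin (x + \<theta>) = 2 * cos \<theta> * sin x - sin (x - \<theta>)" for x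
      by (simp add: sin_add sin_diff)
    have arg: "real (Suc k) * \<theta> = k * \<theta> + \<theta>" by (simp add: algebra_simps)
    have "sin \<theta> * y (Suc (Suc k)) = 2 * cos \<theta> * (sin \<theta> * y (Suc k)) - sin \<theta> * y k"
      by (simp add: rec algebra_simps)
    also have "\<dots> = y 1 * (2 * cos \<theta> * sin (k * \<theta> + \<theta>) - sin (k * \<theta>))
        - y 0 * (2 * cos \<theta> * sin (k * \<theta>) - sin (k * \<theta> - \<theta>))"
      unfolding Suc.IH[THEN conjunct1] Suc.IH[THEN conjunct2] by (simp add: algebra_simps)
    also have "\<dots> = y 1 * sin (k * \<theta> + \<theta> + \<theta>) - y 0 * sin (k * \<theta> + \<theta>)"
      using step[of "k * \<theta> + \<theta>"] step[of "k * \<theta>"] by simp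
    finally show ?case using Suc.IH unfolding arg by simp
  qed simp
  have n\<theta>: "n * \<theta> = 2 * pi" using n by (simp add: \<theta>_def)
  have "sin (2 * pi - \<theta>) = - sin \<theta>" "sin (2 * pi + \<theta>) = sin \<theta>"
    by (simp_all add: sin_diff sin_add)
  then have "sin \<theta> * y n = sin \<theta> * y 0" "sin \<theta> * y (Suc n) = sin \<theta> * y 1"
    using closed[of n] by (simp_all add: n\<theta>)
  then have y: "y n = y 0" "y (Suc n) = y 1" using sin by simp_all
  have shift: "(\<Sum>k<n. f (Suc k)) = (\<Sum>k<n. f k) + f n - f 0" for f :: "nat \<Rightarrow> real"
    using sum.lessThan_Suc_shift[of f n] by simp
  have "(\<Sum>k<n. y (Suc (Suc k))) = 2 * cos \<theta> * (\<Sum>k<n. y (Suc k)) - (\<Sum>k<n. y k)"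
    by (simp add: rec sum_subtractf sum_distrib_left)
  then have "(2 - 2 * cos \<theta>) * (\<Sum>k<n. y k) = 0"
    using shift[of y] shift[of "\<lambda>k. y (Suc k)"] y by (simp add: algebra_simps)
  then show ?thesis using \<open>cos \<theta> \<noteq> 1\<close> by simp
qed

context coxeter
begin

text \<open>Twice the Tits form: \<open>2 B(\<alpha>\<^sub>s, \<alpha>\<^sub>t)\<close>, with \<open>-2\<close> for an infinite entry.\<close>

definition coupling :: "'a \<Rightarrow> 'a \<Rightarrow> real" where
  "coupling s t = (if s = t then 2 else case m s t of enat n \<Rightarrow> - 2 * cos (pi / n) | \<infinity> \<Rightarrow> - 2)"

text \<open>
  The contragredient of the geometric representation, on functions on the simple roots. In this
  form each coordinate can be followed on its own.
\<close>

definition geom_act :: "'a \<Rightarrow> ('a \<Rightarrow> real) \<Rightarrow> 'a \<Rightarrow> real" where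
  "geom_act s f = (\<lambda>u. f u - coupling s u * f s)"

text \<open>
  The coordinates of \<open>(s t)\<^sup>k f\<close> at \<open>s\<close> and \<open>t\<close> evolve by a matrix of determinant \<open>1\<close> and trace
  \<open>\<kappa>\<^sup>2 - 2 = 2 cos (2 \<pi> / n)\<close>, and the increments at any \<open>u\<close> are linear in them. So the
  increments obey the recurrence above and add up to zero over \<open>n\<close> steps. For \<open>n = 2\<close>, where
  \<open>sin \<theta> = 0\<close>, two consecutive increments cancel directly.
\<close>

lemma geom_act_dihedral:
  assumes s: "s \<in> S" and t: "t \<in> S" and ne: "s \<noteq> t" and n: "m s t = enat n"
  shows "((\<lambda>f. geom_act s (geom_act t f)) ^^ n) f = f"
proof
  fix u
  define h where "h k = ((\<lambda>f. geom_act s (geom_act t f)) ^^ k) f" for k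
  define \<kappa> where "\<kappa> = coupling s t"
  have \<kappa>': "coupling t s = \<kappa>" using m_sym[OF s t] by (simp add: \<kappa>_def coupling_def)
  have diag: "coupling s s = 2" "coupling t t = 2" by (simp_all add: coupling_def)
  have \<kappa>: "\<kappa> = - 2 * cos (pi / n)" using n ne by (simp add: \<kappa>_def coupling_def)
  define y where "y k = h (Suc k) u - h k u" for k
  have hs: "h (Suc k) s = - h k s + \<kappa> * h k t"
    and ht: "h (Suc k) t = - \<kappa> * h k s + (\<kappa>\<^sup>2 - 1) * h k t"
    and y: "y k = - coupling t u * h k t - coupling s u * (h k s - \<kappa> * h k t)" for k
    by (simp_all add: h_def y_def geom_act_def diag \<kappa>' \<kappa>_def[symmetric] algebra_simps power2_eq_square)
  have n2: "2 \<le> n" using m_ge_2[OF s t ne] n by (simp add: numeral_eq_enat)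
  have sum: "(\<Sum>k<n. y k) = 0"
  proof (cases "n = 2")
    case True
    with \<kappa> have "\<kappa> = 0" by simp
    then have "y 1 = - y 0" by (simp add: y hs ht)
    then show ?thesis using True by (simp add: numeral_2_eq_2)
  next
    case False
    have "\<kappa>\<^sup>2 - 2 = 2 * cos (2 * pi / n)"
      using cos_double_cos[of "pi / n"] by (simp add: \<kappa> power2_eq_square)
    moreover have "y (Suc (Suc k)) = (\<kappa>\<^sup>2 - 2) * y (Suc k) - y k" for k
      unfolding y hs ht by (simp add: algebra_simps power2_eq_square)
    ultimately show ?thesis using False n2 by (intro recurrence_periodic) auto
  qed
  have "(\<Sum>k<n. y k) = h n u - h 0 u" unfolding y_def by (rule sum_lessThan_telescope)
  with sum show "((\<lambda>f. geom_act s (geom_act t f)) ^^ n) f u = f u" by (simp add: h_def)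
qed

text \<open>
  If \<open>s\<close> and \<open>t\<close> commute, comparing \<open>s t\<close> and \<open>t s\<close> on the indicator function of \<open>t\<close> shows that
  their coupling vanishes, and \<open>cos (\<pi> / n)\<close> is zero only for \<open>n = 2\<close>.
\<close>

lemma commute_iff:
  assumes s: "s \<in> S" and t: "t \<in> S"
  shows "s \<otimes> t = t \<otimes> s \<longleftrightarrow> s = t \<or> m s t = 2"
proof (cases "s = t")
  case ne: False
  have [simp]: "s \<in> carrier W" "t \<in> carrier W" using s t by (auto intro: gens_closed)
  show ?thesis
  proof
    assume "s \<otimes> t = t \<otimes> s"
    then have "prd [s, t] = prd [t, s]" by simp
    then have eq: "pres_eq S (coxeter_relations S m) (pos [s, t]) (pos [t, s])"
      using s t by (subst (asm) prd_eq_iff) auto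
    \<comment> \<open>At \<open>t\<close>, the images of \<open>f\<close> under \<open>s t\<close> and \<open>t s\<close> are \<open>\<kappa>\<^sup>2 - 1\<close> and \<open>-1\<close>, where \<open>\<kappa>\<close> is the coupling.\<close>
    define f where "f = (\<lambda>u. if u = t then 1 else 0 :: real)"
    have "foldr geom_act (map fst (pos [s, t])) f = foldr geom_act (map fst (pos [t, s])) f"
      by (rule involution_action_pres_eq[where D = UNIV and F = geom_act, OF _ _ eq])
        (auto simp: geom_act_dihedral, auto simp: geom_act_def coupling_def fun_eq_iff)
    then have "geom_act s (geom_act t f) t = geom_act t (geom_act s f) t" by (simp add: pos_def)
    then have "coupling s t * coupling t s = 0"
      using ne by (simp add: geom_act_def f_def coupling_def[of t t] algebra_simps)
    moreover have "coupling t s = coupling s t" using m_sym[OF s t] by (simp add: coupling_def)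
    ultimately have zero: "coupling s t = 0" by simp
    then obtain n where n: "m s t = enat n" "cos (pi / n) = 0"
      using ne by (auto simp: coupling_def split: enat.splits)
    have "2 \<le> n" using m_ge_2[OF s t ne] n by (simp add: numeral_eq_enat)
    have "\<not> 3 \<le> n"
    proof
      assume "3 \<le> n"
      then have "0 < cos (pi / n)" by (intro cos_gt_zero) (auto simp: field_simps)
      with n show False by simp
    qed
    with \<open>2 \<le> n\<close> n show "s = t \<or> m s t = 2" by (simp add: numeral_eq_enat)
  next
    assume "s = t \<or> m s t = 2"
    then have "m s t = enat 2" using ne by (simp add: numeral_eq_enat)
    from gen_mult_pow[OF s t ne this] have "(s \<otimes> t) \<otimes> (s \<otimes> t) = \<one>" by (simp add: numeral_2_eq_2)
    then have "s \<otimes> t = inv (s \<otimes> t)" by (intro inv_equality[symmetric]) auto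
    then show "s \<otimes> t = t \<otimes> s" using s t by (simp add: inv_mult_group gen_inv)
  qed
qed simp

lemma m_eq_2_iff: "s \<in> S \<Longrightarrow> t \<in> S \<Longrightarrow> m s t = 2 \<longleftrightarrow> s \<noteq> t \<and> s \<otimes> t = t \<otimes> s"
  using commute_iff[of s t] m_diag[of s] by (auto simp: numeral_eq_enat one_enat_def)

end

section \<open>The longest element of a finite parabolic subgroup\<close>

context group
begin

abbreviation conj_by :: "'a \<Rightarrow> 'a \<Rightarrow> 'a" where
  "conj_by g x \<equiv> g \<otimes> x \<otimes> inv g"

lemma conj_by_mult:
  "g \<in> carrier G \<Longrightarrow> h \<in> carrier G \<Longrightarrow> x \<in> carrier G \<Longrightarrow>
   conj_by (g \<otimes> h) x = conj_by g (conj_by h x)"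
  by (simp add: inv_mult_group m_assoc)

lemma conj_by_inv_cancel:
  assumes "g \<in> carrier G" "x \<in> carrier G"
  shows "conj_by (inv g) (conj_by g x) = x" "conj_by g (conj_by (inv g) x) = x"
  using assms conj_by_mult[of "inv g" g x] conj_by_mult[of g "inv g" x] by (simp_all del: inv_inv)

lemma conj_by_prod:
  assumes "g \<in> carrier G" "x \<in> carrier G" "y \<in> carrier G"
  shows "conj_by g x \<otimes> conj_by g y = conj_by g (x \<otimes> y)"
proof -
  have "inv g \<otimes> (g \<otimes> (y \<otimes> inv g)) = y \<otimes> inv g"
    using assms by (simp flip: m_assoc)
  then show ?thesis using assms by (simp add: m_assoc)
qed

lemma conj_by_hom: "g \<in> carrier G \<Longrightarrow> group_hom G G (conj_by g)"
  by unfold_locales (simp add: hom_def Pi_iff conj_by_prod)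

lemma conj_by_image_inv:
  assumes "g \<in> carrier G" "Y \<subseteq> carrier G"
  shows "conj_by (inv g) ` conj_by g ` Y = Y"
proof -
  have "conj_by (inv g) (conj_by g y) = y" if "y \<in> Y" for y
    using assms that by (intro conj_by_inv_cancel) auto
  then show ?thesis unfolding image_image by simp
qed

lemma conj_by_inj:
  "g \<in> carrier G \<Longrightarrow> x \<in> carrier G \<Longrightarrow> y \<in> carrier G \<Longrightarrow> conj_by g x = conj_by g y \<longleftrightarrow> x = y"
  by simp

end

context coxeter
begin

definition reflections :: "'a set \<Rightarrow> 'a set" where
  "reflections X = {conj_by a x | a x. a \<in> generate W X \<and> x \<in> X}"

text \<open>
  For \<open>r = a x a\<^sup>-\<^sup>1\<close> the cocycle rule yields the contributions of \<open>a\<close> and of \<open>a\<^sup>-\<^sup>1\<close>, which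
  cancel because \<open>a\<^sup>-\<^sup>1 a\<close> has no inversions, and the contribution of \<open>x\<close> itself.
\<close>

lemma reflection_self_inversion:
  assumes a: "a \<in> generate W S" and x: "x \<in> S"
  shows "conj_by a x \<in> inversions (conj_by a x)"
proof -
  let ?r = "conj_by a x"
  have c: "a \<in> carrier W" "x \<in> carrier W" using a x generate_closed gens_closed by auto
  have ia: "inv a \<in> generate W S" using a by (intro generate_inv) auto
  have ax: "a \<otimes> x \<in> generate W S" using a x by (auto intro: generate.eng generate.incl)
  have cancel: "conj_by (inv a) ?r = x" using c by (rule conj_by_inv_cancel)
  have "x \<in> inversions a \<longleftrightarrow> ?r \<in> inversions (inv a)"
    using inversions_mult[OF ia a c(2)] c by simp
  moreover have "x \<in> inversions (a \<otimes> x) \<longleftrightarrow> x \<notin> inversions a"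
    using inversions_mult_gen[OF a x c(2)] c x by (simp add: gen_sq)
  moreover have "?r \<in> inversions ?r \<longleftrightarrow> (?r \<in> inversions (inv a)) \<noteq> (x \<in> inversions (a \<otimes> x))"
    using inversions_mult[OF ax ia, of ?r] c by (simp only: cancel) simp
  ultimately show ?thesis by blast
qed

lemma inversions_reflections:
  assumes X: "X \<subseteq> S" and w: "w \<in> generate W X"
  shows "inversions w \<subseteq> reflections X"
proof -
  have "inversions (prd xs) \<subseteq> reflections X" if "set xs \<subseteq> X" for xs
    using that
  proof (induction xs)
    case (Cons x xs)
    have x: "x \<in> X" "x \<in> S" "x \<in> carrier W" and xs: "prd xs \<in> generate W X"
      using Cons.prems X gens_closed by (auto simp: generate_eq_prd)
    show ?case
    proof
      fix r assume r: "r \<in> inversions (prd (x # xs))"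
      then have rc: "r \<in> carrier W" by (rule inversions_closed)
      show "r \<in> reflections X"
      proof (cases "r \<in> inversions (prd xs)")
        case False
        then have "conj_by (prd xs) r = x"
          using r inversions_mult[of x "prd xs" r] x rc generate_S[OF X xs]
          by (simp add: inversions_gen generate.incl)
        then have "r = conj_by (inv (prd xs)) x"
          using conj_by_inv_cancel(1)[of "prd xs" r] rc generate_closed[OF X xs] by simp
        then show ?thesis using x generate_inv[OF X xs] by (auto simp: reflections_def)
      qed (use Cons in auto)
    qed
  qed simp
  with w X show ?thesis by (auto simp: generate_eq_prd)
qed

lemma reflections_conj:
  assumes X: "X \<subseteq> S" and g: "g \<in> generate W X" and r: "r \<in> carrier W"
  shows "conj_by g r \<in> reflections X \<longleftrightarrow> r \<in> reflections X"
proof -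
  have conj: "conj_by h q \<in> reflections X" if h: "h \<in> generate W X" and q: "q \<in> reflections X" for h q
  proof -
    obtain a x where a: "a \<in> generate W X" and x: "x \<in> X" and q: "q = conj_by a x"
      using q by (auto simp: reflections_def)
    have "conj_by h q = conj_by (h \<otimes> a) x"
      unfolding q using generate_closed[OF X] a h x X gens_closed by (intro conj_by_mult[symmetric]) auto
    with a h x show ?thesis by (auto simp: reflections_def intro!: generate.eng)
  qed
  have "conj_by (inv g) (conj_by g r) = r" using generate_closed[OF X g] r by (rule conj_by_inv_cancel)
  with conj[OF g, of r] conj[OF generate_inv[OF X g], of "conj_by g r"] show ?thesis by auto
qed

text \<open>
  An element of maximal length works: for a reflection \<open>r\<close> that is not an inversion of \<open>w\<close>, the
  element \<open>w r\<close> has \<open>r\<close> as an inversion, hence is longer than \<open>w r r = w\<close>.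
\<close>

lemma exists_full_inversions:
  assumes X: "X \<subseteq> S" and fin: "finite (generate W X)"
  obtains w where "w \<in> generate W X" "inversions w = reflections X"
proof -
  have "generate W X \<noteq> {}" using generate.one by blast
  then have "Max (word_len X ` generate W X) \<in> word_len X ` generate W X"
    using fin by (intro Max_in) auto
  then obtain w where w: "w \<in> generate W X" and "word_len X w = Max (word_len X ` generate W X)"
    by auto
  then have max: "word_len X v \<le> word_len X w" if "v \<in> generate W X" for v
    using fin that by simp
  have "reflections X \<subseteq> inversions w"
  proof
    fix r assume r: "r \<in> reflections X"
    then obtain a x where a: "a \<in> generate W X" and x: "x \<in> X" and r_eq: "r = conj_by a x"
      by (auto simp: reflections_def)
    have rX: "r \<in> generate W X"
      unfolding r_eq using a x generate_inv[OF X a] by (auto intro: generate.eng generate.incl)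
    have rc: "r \<in> carrier W" using generate_closed[OF X rX] .
    have wc: "w \<in> carrier W" using generate_closed[OF X w] .
    have rr: "r \<otimes> r = \<one>"
    proof -
      have c: "a \<in> carrier W" "x \<in> carrier W" using a x X generate_closed gens_closed by auto
      have "r \<otimes> r = conj_by a (x \<otimes> x)"
        using c by (simp add: r_eq conj_by_prod)
      then show ?thesis using c x X by (simp add: gen_sq subset_iff)
    qed
    show "r \<in> inversions w"
    proof (rule ccontr)
      assume "r \<notin> inversions w"
      moreover have "conj_by r r = r" using rc by (simp add: m_assoc)
      moreover have "r \<in> inversions r"
        unfolding r_eq using a x X generate_S[OF X] by (intro reflection_self_inversion) auto
      ultimately have "r \<in> inversions (w \<otimes> r)"
        using inversions_mult[of w r r] generate_S[OF X] w rX rc by simp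
      then have "word_len X (w \<otimes> r \<otimes> r) < word_len X (w \<otimes> r)"
        using w rX by (intro word_len_inversion[OF X]) (auto intro: generate.eng)
      then have "word_len X w < word_len X (w \<otimes> r)" using wc rc by (simp add: m_assoc rr)
      with max[of "w \<otimes> r"] w rX show False by (auto intro: generate.eng)
    qed
  qed
  with inversions_reflections[OF X w] w that show ?thesis by blast
qed

text \<open>
  Let \<open>w\<close> have all reflections of \<open>W\<^sub>X\<close> as inversions; so has \<open>w\<^sup>-\<^sup>1\<close>. For \<open>x \<in> X\<close> the cocycle
  rule then leaves \<open>w x w\<^sup>-\<^sup>1\<close> with itself as its only inversion. As it has a simple inversion,
  it is simple.
\<close>

lemma exists_permuting:
  assumes X: "X \<subseteq> S" "X \<noteq> {}" and fin: "finite (generate W X)"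
  obtains w where "w \<in> generate W X" "w \<noteq> \<one>" "conj_by w ` X = X"
proof -
  obtain w where w: "w \<in> generate W X" and full: "inversions w = reflections X"
    using exists_full_inversions[OF X(1) fin] .
  have wc: "w \<in> carrier W" using generate_closed[OF X(1) w] .
  have wS: "w \<in> generate W S" using generate_S[OF X(1) w] .
  have iw: "inv w \<in> generate W X" using generate_inv[OF X(1) w] .
  have iwS: "inv w \<in> generate W S" using generate_S[OF X(1) iw] .
  have full_inv: "r \<in> inversions (inv w) \<longleftrightarrow> r \<in> reflections X" if r: "r \<in> carrier W" for r
  proof -
    have "(r \<in> inversions (inv w)) = (conj_by (inv w) r \<in> inversions w)"
      using inversions_mult[OF wS iwS r] wc by simp
    then show ?thesis unfolding full reflections_conj[OF X(1) iw r] .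
  qed
  have "conj_by w x \<in> X" if x: "x \<in> X" for x
  proof -
    have xc: "x \<in> carrier W" and xS: "x \<in> S" using x X gens_closed by auto
    have xX: "x \<in> generate W X" using x by (rule generate.incl)
    let ?y = "conj_by w x"
    have y: "?y \<in> generate W X" using w iw xX by (intro generate.eng)
    have "r \<in> inversions ?y \<longleftrightarrow> r = ?y" if r: "r \<in> carrier W" for r
    proof -
      let ?q = "conj_by (inv w) r"
      have q: "?q \<in> carrier W" using r wc by simp
      have "x \<otimes> ?q \<otimes> x \<in> reflections X \<longleftrightarrow> r \<in> reflections X"
        using reflections_conj[OF X(1) xX q] reflections_conj[OF X(1) iw r] gen_inv[OF xS] by simp
      then have "?q \<in> inversions (w \<otimes> x) \<longleftrightarrow> (?q = x) \<noteq> (r \<in> reflections X)"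
        using inversions_mult_gen[OF wS xS q] full by simp
      moreover have "r \<in> inversions ?y \<longleftrightarrow>
          (r \<in> inversions (inv w)) \<noteq> (?q \<in> inversions (w \<otimes> x))"
        using wS iwS xS r by (intro inversions_mult) (auto intro: generate.eng generate.incl)
      ultimately have "r \<in> inversions ?y \<longleftrightarrow> ?q = x" using full_inv[OF r] by blast
      also have "\<dots> \<longleftrightarrow> r = ?y" using conj_by_inv_cancel[of w] wc xc r by metis
      finally show ?thesis .
    qed
    then have inv_y: "inversions ?y = {?y}" using inversions_closed wc xc by fastforce
    then have "?y \<noteq> \<one>" by auto
    with descent[OF X(1) y] inv_y show ?thesis by (metis singletonD)
  qed
  then have "conj_by w ` X \<subseteq> X" by auto
  moreover have "inj_on (conj_by w) X" using X gens_closed wc by (intro inj_onI) (auto simp: subset_iff)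
  moreover have "finite X" using X finite_S finite_subset by blast
  ultimately have "conj_by w ` X = X" by (intro endo_inj_surj)
  moreover have "w \<noteq> \<one>"
  proof
    assume "w = \<one>"
    with full have "reflections X = {}" by simp
    moreover obtain x where "x \<in> X" using X by auto
    then have "conj_by \<one> x \<in> reflections X"
      unfolding reflections_def using generate.one[of W X] by blast
    ultimately show False by simp
  qed
  ultimately show ?thesis using w that by blast
qed

section \<open>Elements permuting the generators of an irreducible parabolic subgroup\<close>

lemma irreducible_cases:
  assumes "irreducible_subset m X" "X \<subseteq> A \<union> B" "A \<inter> B = {}"
    and "\<And>s t. s \<in> X \<inter> A \<Longrightarrow> t \<in> X \<inter> B \<Longrightarrow> m s t = 2"
  shows "X \<subseteq> A \<or> X \<subseteq> B"
proof (rule ccontr)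
  assume "\<not> ?thesis"
  then have "X \<inter> A \<noteq> {}" "X \<inter> B \<noteq> {}" using assms(2) by auto
  moreover have "(X \<inter> A) \<union> (X \<inter> B) = X" "(X \<inter> A) \<inter> (X \<inter> B) = {}" using assms(2,3) by auto
  ultimately show False using assms(1,4) unfolding irreducible_subset_def by blast
qed

text \<open>
  Compare the inversions of the two sides of \<open>w d = d' w\<close>, where \<open>d' = w d w\<^sup>-\<^sup>1\<close> is simple.
\<close>

lemma permuting_inversions_invariant:
  assumes X: "X \<subseteq> S" and w: "w \<in> generate W X" and perm: "conj_by w ` X = X"
    and d: "d \<in> X" and r: "r \<in> carrier W"
  shows "d \<otimes> r \<otimes> d \<in> inversions w \<longleftrightarrow> r \<in> inversions w"
proof -
  have wc: "w \<in> carrier W" and wS: "w \<in> generate W S" and dS: "d \<in> S" and dc: "d \<in> carrier W"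
    using w X d generate_closed generate_S gens_closed by auto
  define d' where "d' = conj_by w d"
  have d': "d' \<in> S" using perm d X by (auto simp: d'_def)
  have "w \<otimes> d = d' \<otimes> w" using wc dc by (simp add: d'_def m_assoc)
  moreover have "r \<in> inversions (w \<otimes> d) \<longleftrightarrow> (r = d) \<noteq> (d \<otimes> r \<otimes> d \<in> inversions w)"
    using wS dS r by (rule inversions_mult_gen)
  moreover have "r \<in> inversions (d' \<otimes> w) \<longleftrightarrow> (r \<in> inversions w) \<noteq> (conj_by w r \<in> inversions d')"
    using wS d' r by (intro inversions_mult) (auto intro: generate.incl)
  moreover have "conj_by w r \<in> inversions d' \<longleftrightarrow> r = d"
    using inversions_gen[OF d'] conj_by_inj[OF wc r dc] by (simp add: d'_def)
  ultimately show ?thesis by auto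
qed

text \<open>
  Let \<open>d \<in> X\<close> be an inversion of \<open>w\<close> and \<open>e \<in> X\<close> not. Then \<open>p = w d\<close> has the inversions of \<open>w\<close>
  except \<open>d\<close>, so neither \<open>d\<close> nor \<open>e\<close>, and hence none in the dihedral group generated by them.
  But \<open>e d e\<close> is an inversion of \<open>w\<close> by invariance. So \<open>e d e = d\<close>: the inversions in \<open>X\<close>
  commute with the rest of \<open>X\<close>, and irreducibility leaves only one of the two parts.
\<close>

lemma permuting_inverts_all:
  assumes X: "X \<subseteq> S" and irr: "irreducible_subset m X"
    and w: "w \<in> generate W X" "w \<noteq> \<one>" and perm: "conj_by w ` X = X"
  shows "X \<subseteq> inversions w"
proof -
  have wS: "w \<in> generate W S" using generate_S[OF X w(1)] .
  have "m d e = 2" if d: "d \<in> X \<inter> inversions w" and e: "e \<in> X \<inter> - inversions w" for d e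
  proof -
    have S: "d \<in> S" "e \<in> S" "d \<in> X" "e \<in> X" and c: "d \<in> carrier W" "e \<in> carrier W"
      using d e X gens_closed by auto
    have "d \<noteq> e" using d e by auto
    moreover have "d \<otimes> e = e \<otimes> d"
    proof (rule ccontr)
      assume ne: "d \<otimes> e \<noteq> e \<otimes> d"
      define p where "p = w \<otimes> d"
      have p: "p \<in> generate W S" using wS S by (auto simp: p_def intro: generate.eng generate.incl)
      have p_inv: "r \<in> inversions p \<longleftrightarrow> r \<in> inversions w \<and> r \<noteq> d" if r: "r \<in> carrier W" for r
        using inversions_mult_gen[OF wS S(1) r] d
          permuting_inversions_invariant[OF X w(1) perm S(3) r] by (auto simp: p_def)
      then have "inversions p \<inter> {d, e} = {}" using c d e by auto
      then have "inversions p \<inter> generate W {d, e} = {}"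
        using S p by (intro parabolic_inversions) auto
      moreover have "e \<otimes> d \<otimes> e \<in> generate W {d, e}" by (intro generate.eng generate.incl) auto
      moreover have "e \<otimes> d \<otimes> e \<noteq> d"
      proof
        assume "e \<otimes> d \<otimes> e = d"
        then have "e \<otimes> d \<otimes> e \<otimes> e = d \<otimes> e" by simp
        with ne c S show False by (simp add: m_assoc gen_sq)
      qed
      moreover have "e \<otimes> d \<otimes> e \<in> inversions w"
        using permuting_inversions_invariant[OF X w(1) perm S(4) c(1)] d by simp
      ultimately show False using p_inv[of "e \<otimes> d \<otimes> e"] c by auto
    qed
    ultimately show "m d e = 2" using m_eq_2_iff S by simp
  qed
  with irr have "X \<subseteq> inversions w \<or> X \<subseteq> - inversions w" by (intro irreducible_cases) auto
  moreover obtain s where "s \<in> X" "s \<in> inversions w" using descent[OF X w] .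
  ultimately show ?thesis by auto
qed

text \<open>
  If \<open>v \<noteq> w\<close>, then \<open>u = v\<^sup>-\<^sup>1 w\<close> also permutes \<open>X\<close>, so all three elements have all of \<open>X\<close> as
  inversions. By the cocycle rule for \<open>w = v u\<close> the contributions of \<open>u\<close> and \<open>v\<close> cancel on \<open>X\<close>.
\<close>

lemma permuting_unique:
  assumes X: "X \<subseteq> S" and irr: "irreducible_subset m X"
    and v: "v \<in> generate W X" "v \<noteq> \<one>" "conj_by v ` X = X"
    and w: "w \<in> generate W X" "w \<noteq> \<one>" "conj_by w ` X = X"
  shows "v = w"
proof (rule ccontr)
  assume ne: "v \<noteq> w"
  have c: "v \<in> carrier W" "w \<in> carrier W" using v w generate_closed[OF X] by auto
  define u where "u = inv v \<otimes> w"
  have u: "u \<in> generate W X" using v w generate_inv[OF X] by (auto simp: u_def intro: generate.eng)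
  have w_eq: "w = v \<otimes> u" using c by (simp add: u_def flip: m_assoc)
  have "u \<noteq> \<one>" using ne w_eq c by auto
  have Xc: "x \<in> carrier W" if "x \<in> X" for x using that X gens_closed by auto
  have "conj_by u ` X = conj_by (inv v) ` conj_by w ` X"
    unfolding image_image u_def using c Xc by (intro image_cong refl conj_by_mult) auto
  also have "conj_by w ` X = conj_by v ` X" using v(3) w(3) by simp
  also have "conj_by (inv v) ` conj_by v ` X = X"
    using c Xc by (intro conj_by_image_inv) auto
  finally have perm: "conj_by u ` X = X" .
  obtain x where x: "x \<in> X" using descent[OF X v(1,2)] by blast
  have inv: "X \<subseteq> inversions u" "X \<subseteq> inversions v" "X \<subseteq> inversions w"
    using permuting_inverts_all[OF X irr] u \<open>u \<noteq> \<one>\<close> perm v w by blast+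
  have "x \<in> inversions w \<longleftrightarrow> (x \<in> inversions u) \<noteq> (conj_by u x \<in> inversions v)"
    unfolding w_eq using v(1) u generate_S[OF X] Xc[OF x] by (intro inversions_mult) auto
  moreover have "conj_by u x \<in> X" using perm x by blast
  ultimately show False using inv x by blast
qed

end

section \<open>The elements \<open>\<omega>\<^sub>X\<close>\<close>

context coxeter
begin

lemma fin_irredD:
  assumes "X \<in> fin_irred W S m"
  shows "X \<subseteq> S" "X \<noteq> {}" "finite (generate W X)" "irreducible_subset m X"
  using assms by (auto simp: fin_irred_def)

lemma omega_eqI:
  assumes X: "X \<in> fin_irred W S m" and "w \<in> generate W X" "w \<noteq> \<one>" "conj_by w ` X = X"
  shows "omega W X = w"
  unfolding omega_def using assms permuting_unique[OF fin_irredD(1,4)[OF X]]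
  by (intro the_equality) auto

lemma omega:
  assumes X: "X \<in> fin_irred W S m"
  shows "omega W X \<in> generate W X" "omega W X \<noteq> \<one>" "conj_by (omega W X) ` X = X"
proof -
  obtain w where w: "w \<in> generate W X" "w \<noteq> \<one>" "conj_by w ` X = X"
    using exists_permuting[OF fin_irredD(1-3)[OF X]] .
  with omega_eqI[OF X w] show "omega W X \<in> generate W X" "omega W X \<noteq> \<one>"
    "conj_by (omega W X) ` X = X" by auto
qed

lemma omega_closed: "X \<in> fin_irred W S m \<Longrightarrow> omega W X \<in> carrier W"
  using generate_closed[OF fin_irredD(1) omega(1)] .

text \<open>The inverse has the defining property, too.\<close>

lemma inv_omega:
  assumes X: "X \<in> fin_irred W S m"
  shows "inv (omega W X) = omega W X"
proof -
  let ?w = "omega W X"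
  have wc: "?w \<in> carrier W" using omega_closed[OF X] .
  have "X \<subseteq> carrier W" using fin_irredD(1)[OF X] gens_closed by auto
  then have "conj_by (inv ?w) ` conj_by ?w ` X = X" by (rule conj_by_image_inv[OF wc])
  then have "conj_by (inv ?w) ` X = X" by (simp only: omega(3)[OF X])
  moreover have "inv ?w \<noteq> \<one>" using omega(2)[OF X] wc by simp
  moreover have "inv ?w \<in> generate W X" using omega(1)[OF X] fin_irredD(1)[OF X] by (intro generate_inv)
  ultimately have "?w = inv ?w" by (intro omega_eqI[OF X])
  then show ?thesis by (rule HOL.sym)
qed

lemma omega_conj_eq: "X \<in> fin_irred W S m \<Longrightarrow> omega_conj W X Y = conj_by (omega W X) ` Y"
  by (simp add: omega_conj_def inv_omega)

lemma omega_conj_self: "X \<in> fin_irred W S m \<Longrightarrow> omega_conj W X X = X"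
  by (simp add: omega_conj_eq omega(3))

lemma omega_conj_omega_conj:
  assumes X: "X \<in> fin_irred W S m" and "Y \<subseteq> S"
  shows "omega_conj W X (omega_conj W X Y) = Y"
proof -
  have "conj_by (omega W X) (conj_by (omega W X) y) = y" if "y \<in> Y" for y
    using conj_by_inv_cancel(1)[of "omega W X" y] omega_closed[OF X] inv_omega[OF X] gens_closed[of y]
      assms(2) that by auto
  then show ?thesis unfolding omega_conj_eq[OF X] image_image by simp
qed

lemma omega_conj_psubset:
  assumes X: "X \<in> fin_irred W S m" and "Y \<subset> Z" "Z \<subseteq> S"
  shows "omega_conj W X Y \<subset> omega_conj W X Z"
proof -
  have "omega_conj W X Y \<noteq> omega_conj W X Z"
  proof
    assume "omega_conj W X Y = omega_conj W X Z"
    then have "omega_conj W X (omega_conj W X Y) = omega_conj W X (omega_conj W X Z)" by (rule arg_cong)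
    with assms show False by (simp add: omega_conj_omega_conj)
  qed
  then show ?thesis using assms(2) unfolding omega_conj_def by blast
qed

text \<open>
  An entry \<open>2\<close> is visible in \<open>W\<close> as commutation, so it is preserved when a conjugation maps
  generators to generators.
\<close>

lemma m_conj_eq_2:
  assumes "g \<in> carrier W" "s \<in> S" "t \<in> S" "conj_by g s \<in> S" "conj_by g t \<in> S"
  shows "m (conj_by g s) (conj_by g t) = 2 \<longleftrightarrow> m s t = 2"
proof -
  have c: "s \<in> carrier W" "t \<in> carrier W" using assms gens_closed by auto
  have "conj_by g s \<otimes> conj_by g t = conj_by g t \<otimes> conj_by g s \<longleftrightarrow> s \<otimes> t = t \<otimes> s"
    using c assms(1) conj_by_inj[of g "s \<otimes> t" "t \<otimes> s"] by (simp only: conj_by_prod m_closed)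
  then show ?thesis using assms c by (simp add: m_eq_2_iff)
qed

lemma irreducible_conj:
  assumes g: "g \<in> carrier W" and Y: "Y \<subseteq> S" "conj_by g ` Y \<subseteq> S"
    and irr: "irreducible_subset m (conj_by g ` Y)"
  shows "irreducible_subset m Y"
  unfolding irreducible_subset_def
proof (rule notI, elim exE conjE)
  fix A B
  assume AB: "A \<union> B = Y" "A \<inter> B = {}" "A \<noteq> {}" "B \<noteq> {}" "\<forall>s\<in>A. \<forall>t\<in>B. m s t = 2"
  have inj: "inj_on (conj_by g) Y"
    using g Y(1) gens_closed by (intro inj_onI) (auto simp: subset_iff)
  have "conj_by g ` A \<union> conj_by g ` B = conj_by g ` Y" using AB(1) by auto
  moreover have "conj_by g ` A \<inter> conj_by g ` B = {}"
    using inj_on_image_Int[OF inj, of A B] AB by auto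
  moreover have "\<forall>s\<in>conj_by g ` A. \<forall>t\<in>conj_by g ` B. m s t = 2"
  proof (intro ballI, elim imageE)
    fix s' t' s t assume s: "s \<in> A" and t: "t \<in> B" and eq: "s' = conj_by g s" "t' = conj_by g t"
    have "s \<in> Y" "t \<in> Y" using s t AB(1) by auto
    then have S: "s \<in> S" "t \<in> S" "conj_by g s \<in> S" "conj_by g t \<in> S"
      using Y by (auto simp: image_subset_iff)
    from s t AB(5) show "m s' t' = 2" unfolding eq m_conj_eq_2[OF g S] by blast
  qed
  ultimately show False using irr AB(3,4) unfolding irreducible_subset_def by blast
qed

lemma fin_irred_conj:
  assumes g: "g \<in> carrier W" and Y: "Y \<in> fin_irred W S m" and gY: "conj_by g ` Y \<subseteq> S"
  shows "conj_by g ` Y \<in> fin_irred W S m"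
proof -
  have YS: "Y \<subseteq> S" using fin_irredD(1)[OF Y] .
  have Yc: "Y \<subseteq> carrier W" using YS gens_closed by auto
  interpret c: group_hom W W "conj_by g"
    using g by (rule conj_by_hom)
  have "finite (generate W (conj_by g ` Y))"
    using c.generate_img[OF Yc] fin_irredD(3)[OF Y] by simp
  moreover have "irreducible_subset m (conj_by g ` Y)"
    using irreducible_conj[of "inv g" "conj_by g ` Y"] conj_by_image_inv[OF g Yc] g gY YS
      fin_irredD(4)[OF Y] by simp
  ultimately show ?thesis using gY fin_irredD(2)[OF Y] by (auto simp: fin_irred_def)
qed

lemma omega_conj_fin_irred:
  "X \<in> fin_irred W S m \<Longrightarrow> Y \<in> fin_irred W S m \<Longrightarrow> omega_conj W X Y \<subseteq> S \<Longrightarrow>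
   omega_conj W X Y \<in> fin_irred W S m"
  using fin_irred_conj[OF omega_closed] by (simp add: omega_conj_eq)

lemma reducible_omega_conj:
  assumes X: "X \<in> fin_irred W S m" and "Y \<subseteq> S" "omega_conj W X Y \<subseteq> S"
    and "Z \<subseteq> S" "omega_conj W X Z \<subseteq> S" and "\<not> irreducible_subset m (Y \<union> Z)"
  shows "\<not> irreducible_subset m (omega_conj W X Y \<union> omega_conj W X Z)"
  using irreducible_conj[OF omega_closed[OF X], of "Y \<union> Z"] assms
  by (auto simp: omega_conj_eq image_Un)

text \<open>The right-hand side permutes \<open>\<omega>\<^sub>X(Y)\<close>; uniqueness does the rest.\<close>

lemma omega_omega_conj:
  assumes X: "X \<in> fin_irred W S m" and Y: "Y \<in> fin_irred W S m" and "omega_conj W X Y \<subseteq> S"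
  shows "omega W (omega_conj W X Y) = omega W X \<otimes> omega W Y \<otimes> omega W X"
proof -
  let ?g = "omega W X"
  have g: "?g \<in> carrier W" using omega_closed[OF X] .
  have Yc: "Y \<subseteq> carrier W" using fin_irredD(1)[OF Y] gens_closed by auto
  have w: "omega W Y \<in> carrier W" using omega_closed[OF Y] .
  interpret c: group_hom W W "conj_by ?g"
    using g by (rule conj_by_hom)
  have "conj_by ?g (omega W Y) \<in> generate W (conj_by ?g ` Y)"
    using omega(1)[OF Y] c.generate_img[OF Yc] by auto
  moreover have "conj_by ?g (omega W Y) \<noteq> \<one>"
    using omega(2)[OF Y] conj_by_inj[OF g w one_closed] g by simp
  moreover have "conj_by (conj_by ?g (omega W Y)) ` conj_by ?g ` Y = conj_by ?g ` Y"
  proof -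
    have "conj_by (conj_by ?g (omega W Y)) (conj_by ?g y) = conj_by ?g (conj_by (omega W Y) y)"
      if "y \<in> Y" for y
      using g w Yc that by (simp add: subset_iff flip: c.hom_inv)
    then have "conj_by (conj_by ?g (omega W Y)) ` conj_by ?g ` Y = conj_by ?g ` conj_by (omega W Y) ` Y"
      unfolding image_image by simp
    then show ?thesis by (simp only: omega(3)[OF Y])
  qed
  ultimately have "omega W (conj_by ?g ` Y) = conj_by ?g (omega W Y)"
    using omega_conj_fin_irred[OF X Y assms(3)] by (intro omega_eqI) (simp_all only: omega_conj_eq[OF X] not_False_eq_True)
  then show ?thesis by (simp only: omega_conj_eq[OF X] inv_omega[OF X])
qed

lemma omega_conj_conj:
  assumes X: "X \<in> fin_irred W S m" and Y: "Y \<in> fin_irred W S m" and XY: "omega_conj W X Y \<subseteq> S"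
    and "Z \<subseteq> S"
  shows "omega_conj W (omega_conj W X Y) Z = omega_conj W X (omega_conj W Y (omega_conj W X Z))"
proof -
  let ?g = "omega W X" and ?h = "omega W Y"
  have c: "?g \<in> carrier W" "?h \<in> carrier W" using omega_closed X Y by auto
  have "Z \<subseteq> carrier W" using assms(4) gens_closed by auto
  then have eq: "conj_by (?g \<otimes> ?h \<otimes> ?g) z = conj_by ?g (conj_by ?h (conj_by ?g z))" if "z \<in> Z" for z
    using c that by (simp only: conj_by_mult m_closed inv_closed subset_iff)
  have "omega_conj W (omega_conj W X Y) Z = conj_by (?g \<otimes> ?h \<otimes> ?g) ` Z"
    by (simp only: omega_conj_eq[OF omega_conj_fin_irred[OF X Y XY]] omega_omega_conj[OF X Y XY])
  also have "\<dots> = omega_conj W X (omega_conj W Y (omega_conj W X Z))"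
    unfolding omega_conj_eq[OF X] omega_conj_eq[OF Y] image_image
    using eq by (intro image_cong HOL.refl)
  finally show ?thesis .
qed

lemma omega_conj_Omega\<^sub>0:
  assumes X: "X \<in> fin_irred W S m" and Y: "Y \<in> Omega\<^sub>0 W S m X"
  shows "omega_conj W X Y \<in> Omega\<^sub>0 W S m X"
proof -
  have "omega_conj W X Y \<subset> X"
    using omega_conj_psubset[OF X, of Y X] Y fin_irredD(1)[OF X] omega_conj_self[OF X]
    by (simp add: Omega\<^sub>0_def)
  moreover from this have "omega_conj W X Y \<in> fin_irred W S m"
    using X Y fin_irredD(1)[OF X] by (intro omega_conj_fin_irred) (auto simp: Omega\<^sub>0_def)
  ultimately show ?thesis by (simp add: Omega\<^sub>0_def)
qed

section \<open>The decomposition of \<open>\<Omega>(X)\<close>\<close>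

text \<open>A splitting of \<open>Y \<union> X\<close> cannot split \<open>X\<close> or \<open>Y\<close>, so it separates them.\<close>

lemma reducible_union_commute:
  assumes X: "X \<in> fin_irred W S m" and Y: "Y \<in> fin_irred W S m"
    and red: "\<not> irreducible_subset m (Y \<union> X)" and x: "x \<in> X" and y: "y \<in> Y"
  shows "x \<otimes> y = y \<otimes> x"
proof -
  obtain A B where AB: "A \<union> B = Y \<union> X" "A \<inter> B = {}" "A \<noteq> {}" "B \<noteq> {}"
    and 2: "\<And>s t. s \<in> A \<Longrightarrow> t \<in> B \<Longrightarrow> m s t = 2"
    using red unfolding irreducible_subset_def by blast
  have "X \<subseteq> A \<or> X \<subseteq> B" "Y \<subseteq> A \<or> Y \<subseteq> B"
    using AB 2 fin_irredD(4)[OF X] fin_irredD(4)[OF Y] by (intro irreducible_cases; blast)+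
  then have "m x y = 2 \<or> m y x = 2" using AB 2 x y by blast
  then show ?thesis using m_eq_2_iff x y fin_irredD(1)[OF X] fin_irredD(1)[OF Y] by (metis subsetD)
qed

lemma conj_by_centralizes:
  assumes X: "X \<subseteq> S" and w: "w \<in> generate W X" and y: "y \<in> carrier W"
    and comm: "\<And>x. x \<in> X \<Longrightarrow> x \<otimes> y = y \<otimes> x"
  shows "conj_by w y = y"
proof -
  have "conj_by (prd xs) y = y" if "set xs \<subseteq> X" for xs
    using that
  proof (induction xs)
    case (Cons x xs)
    have c: "x \<in> carrier W" "prd xs \<in> carrier W"
      using Cons.prems X gens_closed prd_closed[of xs] by auto
    have "conj_by (prd (x # xs)) y = conj_by x (conj_by (prd xs) y)"
      using c y by (simp add: conj_by_mult)
    also have "\<dots> = conj_by x y" using Cons by simp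
    also have "\<dots> = y" using comm[of x] Cons.prems c y by (simp add: m_assoc)
    finally show ?case .
  qed (use y in simp)
  with w X show ?thesis by (auto simp: generate_eq_prd)
qed

lemma omega_conj_Omega\<^sub>1:
  assumes X: "X \<in> fin_irred W S m" and Y: "Y \<in> Omega\<^sub>1 W S m X"
  shows "omega_conj W X Y = Y"
proof -
  have "conj_by (omega W X) y = y" if "y \<in> Y" for y
    using that X Y fin_irredD(1)[of Y] gens_closed reducible_union_commute[OF X, of Y _ y]
    by (intro conj_by_centralizes[OF fin_irredD(1)[OF X] omega(1)[OF X]]) (auto simp: Omega\<^sub>1_def)
  then show ?thesis by (simp add: omega_conj_eq[OF X])
qed

lemma gen_in_parabolic:
  assumes I: "I \<subseteq> S" and s: "s \<in> S" "s \<in> generate W I"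
  shows "s \<in> I"
proof -
  have "s \<noteq> \<one>" using inversions_gen[OF s(1)] by auto
  with descent[OF I s(2)] inversions_gen[OF s(1)] show ?thesis by auto
qed

text \<open>
  If \<open>\<omega>\<^sub>X s \<omega>\<^sub>X\<close> is a generator, it lies in \<open>X \<union> {s}\<close> but not in \<open>X\<close>, so \<open>s\<close> commutes with
  \<open>\<omega>\<^sub>X\<close>. Comparing inversions of \<open>\<omega>\<^sub>X s = s \<omega>\<^sub>X\<close> shows that \<open>s x s\<close> is an inversion of \<open>\<omega>\<^sub>X\<close> and
  so lies in \<open>W\<^sub>X\<close>. Then \<open>s\<close> is not an inversion of \<open>s x s\<close>, which by the cocycle rule is only
  possible if \<open>x s x = s\<close>.
\<close>

lemma omega_conj_outside:
  assumes X: "X \<in> fin_irred W S m" and s: "s \<in> S" "s \<notin> X"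
    and conj: "conj_by (omega W X) s \<in> S" and x: "x \<in> X"
  shows "m s x = 2"
proof -
  let ?w = "omega W X" and ?t = "conj_by (omega W X) s"
  have XS: "X \<subseteq> S" and wX: "?w \<in> generate W X" and wc: "?w \<in> carrier W"
    using X fin_irredD omega omega_closed by auto
  have wS: "?w \<in> generate W S" using generate_S[OF XS wX] .
  have c: "s \<in> carrier W" "x \<in> carrier W" and xS: "x \<in> S" using s x XS gens_closed by auto
  have ?thesis if "s \<notin> generate W X"
  proof -
    have "?t \<notin> X"
    proof
      assume t: "?t \<in> X"
      have "conj_by (inv ?w) ?t \<in> generate W X"
        using generate.eng[OF generate.eng[OF generate_inv[OF XS wX] generate.incl[OF t]]
          generate_inv[OF XS generate_inv[OF XS wX]]] .
      with that conj_by_inv_cancel(1)[OF wc c(1)] show False by simp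
    qed
    moreover have "?t \<in> generate W (insert s X)"
      using mono_generate[of X "insert s X"] wX generate_inv[OF XS wX]
      by (intro generate.eng) (auto intro: generate.incl)
    ultimately have t: "?t = s" using gen_in_parabolic[of "insert s X"] conj XS s by auto
    have ws: "?w \<otimes> s = s \<otimes> ?w"
    proof -
      have "?w \<otimes> s = ?t \<otimes> ?w" using wc c by (simp add: m_assoc)
      then show ?thesis by (simp only: t)
    qed
    have "s \<otimes> x \<otimes> s \<in> inversions ?w"
    proof -
      have "x \<in> inversions ?w"
        using permuting_inverts_all[OF XS fin_irredD(4)[OF X] omega[OF X]] x by auto
      moreover have "x \<in> inversions (?w \<otimes> s) \<longleftrightarrow> (x = s) \<noteq> (s \<otimes> x \<otimes> s \<in> inversions ?w)"
        using wS s(1) c(2) by (rule inversions_mult_gen)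
      moreover have "x \<in> inversions (s \<otimes> ?w) \<longleftrightarrow> (x \<in> inversions ?w) \<noteq> (conj_by ?w x \<in> inversions s)"
        using wS s(1) c(2) by (intro inversions_mult) (auto intro: generate.incl)
      moreover have "conj_by ?w x \<in> inversions s \<longleftrightarrow> x = s"
        using inversions_gen[OF s(1)] t conj_by_inj[OF wc c(2,1)] by simp
      ultimately show ?thesis using ws by auto
    qed
    then have "s \<otimes> x \<otimes> s \<in> generate W X" using inversions_generate[OF XS wX] by auto
    then have "s \<notin> inversions (s \<otimes> x \<otimes> s)" using inversions_generate[OF XS] that by blast
    moreover have sx: "s \<otimes> x \<in> generate W S" and "s \<in> generate W S"
      using s xS by (auto intro: generate.eng generate.incl)
    then have "s \<in> inversions (s \<otimes> x \<otimes> s) \<longleftrightarrow> s \<notin> inversions (s \<otimes> x)"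
      using inversions_mult_gen[OF sx s(1) c(1)] c s(1) by (simp add: gen_sq)
    moreover have "s \<in> inversions (s \<otimes> x) \<longleftrightarrow> (s = x) \<noteq> (x \<otimes> s \<otimes> x \<in> inversions s)"
      using \<open>s \<in> generate W S\<close> xS c(1) by (rule inversions_mult_gen)
    ultimately have "x \<otimes> s \<otimes> x = s" using inversions_gen[OF s(1)] s x by auto
    then have "x \<otimes> s \<otimes> x \<otimes> x = s \<otimes> x" by simp
    then have "x \<otimes> s = s \<otimes> x" using c xS by (simp add: m_assoc gen_sq)
    then show ?thesis using m_eq_2_iff[of s x] s x xS by auto
  qed
  then show ?thesis using gen_in_parabolic[OF XS s(1)] s(2) by blast
qed

text \<open>
  The part of \<open>Y\<close> outside \<open>X\<close> is joined to \<open>X\<close> by entries \<open>2\<close> only. As \<open>Y\<close> is irreducible, it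
  lies inside \<open>X\<close> or is disjoint from \<open>X\<close>.
\<close>

lemma Omega_cases:
  assumes X: "X \<in> fin_irred W S m" and Y: "Y \<in> Omega W S m X"
  shows "Y \<in> Omega\<^sub>0 W S m X \<or> Y \<in> Omega\<^sub>1 W S m X"
proof (cases "Y \<subseteq> X")
  case True
  with Y show ?thesis by (auto simp: Omega_def Omega\<^sub>0_def)
next
  case False
  have Y': "Y \<in> fin_irred W S m" "omega_conj W X Y \<subseteq> S" using Y by (auto simp: Omega_def)
  have 2: "m s x = 2" if "s \<in> Y - X" "x \<in> X" for s x
    using that Y' fin_irredD(1)[OF Y'(1)] by (intro omega_conj_outside[OF X]) (auto simp: omega_conj_eq[OF X])
  have "Y \<subseteq> Y - X \<or> Y \<subseteq> X"
    using fin_irredD(4)[OF Y'(1)] 2 by (intro irreducible_cases) auto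
  with False have "Y \<inter> X = {}" by auto
  moreover have "Y \<noteq> {}" "X \<noteq> {}" using fin_irredD(2) X Y' by auto
  ultimately have "\<not> irreducible_subset m (Y \<union> X)"
    using 2 unfolding irreducible_subset_def by blast
  then show ?thesis using Y' by (simp add: Omega\<^sub>1_def)
qed

end

section \<open>Presenting the cactus group by a section\<close>

lemma (in group) involutions_commute_iff:
  assumes [simp]: "a \<in> carrier G" "b \<in> carrier G" and sq: "a \<otimes> a = \<one>" "b \<otimes> b = \<one>"
  shows "a \<otimes> b \<otimes> (a \<otimes> b) = \<one> \<longleftrightarrow> a \<otimes> b = b \<otimes> a"
proof -
  have "inv a = a" "inv b = b" using sq by (auto intro: inv_equality)
  then have inv: "inv (a \<otimes> b) = b \<otimes> a" by (simp add: inv_mult_group)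
  show ?thesis
  proof
    assume "a \<otimes> b \<otimes> (a \<otimes> b) = \<one>"
    then have "inv (a \<otimes> b) = a \<otimes> b" by (intro inv_equality) auto
    with inv show "a \<otimes> b = b \<otimes> a" by simp
  next
    assume "a \<otimes> b = b \<otimes> a"
    with inv have "inv (a \<otimes> b) = a \<otimes> b" by simp
    with r_inv[of "a \<otimes> b"] show "a \<otimes> b \<otimes> (a \<otimes> b) = \<one>" by simp
  qed
qed

text \<open>
  The group \<open>G\<close> is a target in which a family of elements is to satisfy relations; below it is
  once the cactus group and once the group presented over \<open>\<Lambda>\<close>.
\<close>

locale cactus_section = cox: coxeter W S m + G: group G for W S m and G (structure) +
  fixes \<Lambda> :: "'a set set" and \<Psi> :: "'a set \<Rightarrow> 'a set \<times> 'a set"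
  assumes is_section: "is_section W S m \<Lambda> \<Psi>"
begin

abbreviation \<F> :: "'a set set" where "\<F> \<equiv> fin_irred W S m"
abbreviation \<omega> :: "'a set \<Rightarrow> 'a set \<Rightarrow> 'a set" where "\<omega> \<equiv> omega_conj W"
abbreviation bar :: "'a set \<Rightarrow> 'a set" where "bar X \<equiv> fst (\<Psi> X)"
abbreviation ring :: "'a set \<Rightarrow> 'a set" where "ring X \<equiv> snd (\<Psi> X)"

lemma \<Lambda>_\<F>: "X \<in> \<Lambda> \<Longrightarrow> X \<in> \<F>"
  and bar_\<Lambda>: "X \<in> \<F> \<Longrightarrow> bar X \<in> \<Lambda>"
  and ring_\<Lambda>: "X \<in> \<F> \<Longrightarrow> ring X \<in> \<Lambda>"
  and \<Psi>_\<Lambda>: "X \<in> \<Lambda> \<Longrightarrow> \<Psi> X = (X, X)"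
  and \<omega>_bar_ring: "X \<in> \<F> \<Longrightarrow> \<omega> (bar X) (ring X) = X"
  and section_cover: "Y \<in> \<F> \<Longrightarrow> Z \<in> \<F> \<Longrightarrow> \<not> irreducible_subset m (Y \<union> Z) \<Longrightarrow>
    \<exists>X\<in>\<Lambda>. Y \<in> Omega W S m X \<and> Z \<in> Omega W S m X \<and> {\<omega> X Y, \<omega> X Z} \<inter> \<Lambda> \<noteq> {}"
  using is_section unfolding is_section_def by (auto simp: mem_Times_iff)

lemma ring_subset_bar: "X \<in> \<F> \<Longrightarrow> ring X \<subseteq> bar X"
  using is_section unfolding is_section_def by blast

text \<open>If the two components of \<open>\<Psi> X\<close> agreed, then \<open>X\<close> would be \<open>\<omega>\<^bsub>X'\<^esub>(X') = X' \<in> \<Lambda>\<close>.\<close>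

lemma ring_Omega\<^sub>0_bar:
  assumes X: "X \<in> \<F>" "X \<notin> \<Lambda>"
  shows "ring X \<in> Omega\<^sub>0 W S m (bar X)"
proof -
  have "ring X \<noteq> bar X"
    using \<omega>_bar_ring[OF X(1)] cox.omega_conj_self[OF \<Lambda>_\<F>[OF bar_\<Lambda>[OF X(1)]]] bar_\<Lambda>[OF X(1)] X(2)
    by auto
  then show ?thesis
    using ring_subset_bar[OF X(1)] \<Lambda>_\<F>[OF ring_\<Lambda>[OF X(1)]] by (auto simp: Omega\<^sub>0_def)
qed

lemma Omega_\<F>: "X \<in> \<F> \<Longrightarrow> Y \<in> Omega W S m X \<Longrightarrow> Y \<in> \<F> \<and> \<omega> X Y \<in> \<F>"
  using cox.omega_conj_fin_irred[of X Y] by (auto simp: Omega_def)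

text \<open>
  For \<open>X \<notin> \<Lambda>\<close> the first claim is the nesting relation for the components of \<open>\<Psi> X\<close>. It turns the
  relations over \<open>\<Lambda>\<close> into cactus relations, where \<open>(c\<^sub>X c\<^sub>Y)\<^sup>2 = 1\<close> means commutation because
  the generators are involutions.
\<close>

lemma section_relations_hold:
  assumes c: "c \<in> \<F> \<rightarrow> carrier G" and sat: "satisfies G c \<F> (cactus_relations W S m)"
  shows "X \<in> \<F> \<Longrightarrow> c X = c (bar X) \<otimes> c (ring X) \<otimes> c (bar X)"
    and "satisfies G c \<Lambda> (section_relations W S m \<Lambda> \<Psi>)"
proof -
  have cl [simp]: "c X \<in> carrier G" if "X \<in> \<F>" for X using c that by auto
  have sq: "c X \<otimes> c X = \<one>" if X: "X \<in> \<F>" for X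
  proof -
    have "(pos [X, X], pos []) \<in> cactus_relations W S m"
      using X by (auto simp: cactus_relations_def pos_def)
    from satisfies_pos[OF sat this] X show ?thesis by simp
  qed
  have nest: "c X \<otimes> c Y = c (\<omega> X Y) \<otimes> c X" if X: "X \<in> \<F>" and Y: "Y \<in> Omega\<^sub>0 W S m X" for X Y
  proof -
    have "(pos [X, Y], pos [\<omega> X Y, X]) \<in> cactus_relations W S m"
      using X Y by (auto simp: cactus_relations_def)
    moreover have "Y \<in> \<F>" "\<omega> X Y \<in> \<F>"
      using Y cox.omega_conj_Omega\<^sub>0[OF X Y] by (auto simp: Omega\<^sub>0_def)
    ultimately show ?thesis using satisfies_pos[OF sat] X by fastforce
  qed
  have comm: "c Y \<otimes> c X = c X \<otimes> c Y" if X: "X \<in> \<F>" and Y: "Y \<in> Omega\<^sub>1 W S m X" for X Y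
  proof -
    have "(pos [Y, X], pos [X, Y]) \<in> cactus_relations W S m"
      using X Y by (auto simp: cactus_relations_def)
    moreover have "Y \<in> \<F>" using Y by (auto simp: Omega\<^sub>1_def)
    ultimately show ?thesis using satisfies_pos[OF sat] X by fastforce
  qed
  show bar_ring: "c X = c (bar X) \<otimes> c (ring X) \<otimes> c (bar X)" if X: "X \<in> \<F>" for X
  proof (cases "X \<in> \<Lambda>")
    case True
    then show ?thesis using X by (simp add: \<Psi>_\<Lambda> sq)
  next
    case False
    have F: "bar X \<in> \<F>" "ring X \<in> \<F>" using X bar_\<Lambda> ring_\<Lambda> \<Lambda>_\<F> by auto
    have "c (bar X) \<otimes> c (ring X) = c X \<otimes> c (bar X)"
      using nest[OF F(1) ring_Omega\<^sub>0_bar[OF X False]] by (simp only: \<omega>_bar_ring[OF X])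
    then show ?thesis using F X by (simp add: G.m_assoc sq)
  qed
  show "satisfies G c \<Lambda> (section_relations W S m \<Lambda> \<Psi>)"
    unfolding satisfies_def
  proof (intro ballI, clarify)
    fix u v assume "(u, v) \<in> section_relations W S m \<Lambda> \<Psi>"
    then consider
        (1) X where "X \<in> \<Lambda>" "u = pos [X, X]" "v = []"
      | (2) X Y where "X \<in> \<Lambda>" "Y \<in> Omega\<^sub>0 W S m X" "u = pos [X, Y]" "v = pos [\<omega> X Y, X]"
      | (3) X A B where "X \<in> \<Lambda>" "A \<in> Omega\<^sub>0 W S m X" "B \<in> Omega\<^sub>0 W S m X"
          "\<omega> (bar B) (ring B) = \<omega> X (\<omega> (bar A) (ring A))"
          "u = pos [X, bar A, ring A, bar A]" "v = pos [bar B, ring B, bar B, X]"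
      | (4) X Y where "X \<in> \<Lambda>" "Y \<in> Omega\<^sub>0 W S m X"
          "u = pos [X, Y, X]" "v = pos [bar (\<omega> X Y), ring (\<omega> X Y), bar (\<omega> X Y)]"
      | (5) X Y where "X \<in> \<Lambda>" "Y \<in> Omega\<^sub>1 W S m X" "u = pos [X, Y, X, Y]" "v = []"
      | (6) Z A where "Z \<in> \<Lambda>" "A \<in> Omega\<^sub>1 W S m Z"
          "u = pos [bar A, ring A, bar A, Z, bar A, ring A, bar A, Z]" "v = []"
      unfolding section_relations_def
    proof (elim UnE, goal_cases)
      case 3
      then obtain X Y Z Y' Z' A B where "X \<in> \<Lambda>" "A \<in> Omega\<^sub>0 W S m X" "B \<in> Omega\<^sub>0 W S m X"
        and AB: "(Y, Z) = \<Psi> A" "(Y', Z') = \<Psi> B" and "\<omega> Y' Z' = \<omega> X (\<omega> Y Z)"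
        and "u = pos [X, Y, Z, Y]" "v = pos [Y', Z', Y', X]" by blast
      moreover have "bar A = Y" "ring A = Z" "bar B = Y'" "ring B = Z'"
        using AB by (simp_all flip: AB)
      ultimately show ?case using 3(3) by blast
    next
      case 6
      then obtain X Y Z A where "Z \<in> \<Lambda>" "A \<in> Omega\<^sub>1 W S m Z" and A: "(X, Y) = \<Psi> A"
        and "u = pos [X, Y, X, Z, X, Y, X, Z]" "v = []" by (auto simp: pos_def)
      moreover have "bar A = X" "ring A = Y" using A by (simp_all flip: A)
      ultimately show ?case using 6(6) by blast
    qed (simp only: mem_Collect_eq Pair_inject pos_def[of "[]"] list.map; blast)+
    then show "signed_prod G c u = signed_prod G c v"
    proof cases
      case 1
      then show ?thesis by (simp add: sq \<Lambda>_\<F>)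
    next
      case 2
      then have "X \<in> \<F>" "Y \<in> \<F>" "\<omega> X Y \<in> \<F>"
        using \<Lambda>_\<F> cox.omega_conj_Omega\<^sub>0[of X Y] by (auto simp: Omega\<^sub>0_def)
      with 2 show ?thesis by (simp add: nest)
    next
      case 3
      have F: "X \<in> \<F>" "A \<in> \<F>" "B \<in> \<F>" "bar A \<in> \<F>" "ring A \<in> \<F>" "bar B \<in> \<F>" "ring B \<in> \<F>"
        using 3(1-3) \<Lambda>_\<F> bar_\<Lambda> ring_\<Lambda> by (auto simp: Omega\<^sub>0_def)
      have "B = \<omega> X A" using 3(4) F by (simp add: \<omega>_bar_ring)
      with nest[OF F(1) 3(2)] have "c X \<otimes> c A = c B \<otimes> c X" by simp
      then show ?thesis
        unfolding bar_ring[OF F(2)] bar_ring[OF F(3)] using F by (simp add: 3(5,6) G.m_assoc)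
    next
      case 4
      have F: "X \<in> \<F>" "Y \<in> \<F>" and Z: "\<omega> X Y \<in> \<F>"
        using 4(1,2) \<Lambda>_\<F> cox.omega_conj_Omega\<^sub>0[of X Y] by (auto simp: Omega\<^sub>0_def)
      have F': "bar (\<omega> X Y) \<in> \<F>" "ring (\<omega> X Y) \<in> \<F>" using Z \<Lambda>_\<F> bar_\<Lambda> ring_\<Lambda> by auto
      have "c X \<otimes> c Y \<otimes> c X = c (\<omega> X Y)"
        using nest[OF F(1) 4(2)] F Z by (simp add: G.m_assoc sq)
      then show ?thesis unfolding bar_ring[OF Z] using F F' by (simp add: 4(3,4) G.m_assoc)
    next
      case 5
      have F: "X \<in> \<F>" "Y \<in> \<F>" using 5(1,2) \<Lambda>_\<F> by (auto simp: Omega\<^sub>1_def)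
      have "c X \<otimes> c Y \<otimes> (c X \<otimes> c Y) = \<one>"
        using comm[OF F(1) 5(2)] F G.involutions_commute_iff[of "c X" "c Y"] by (simp add: sq)
      then show ?thesis using F by (simp add: 5(3,4) G.m_assoc)
    next
      case 6
      have F: "Z \<in> \<F>" "A \<in> \<F>" "bar A \<in> \<F>" "ring A \<in> \<F>"
        using 6(1,2) \<Lambda>_\<F> bar_\<Lambda> ring_\<Lambda> by (auto simp: Omega\<^sub>1_def)
      have "c A \<otimes> c Z \<otimes> (c A \<otimes> c Z) = \<one>"
        using comm[OF F(1) 6(2)] F G.involutions_commute_iff[of "c A" "c Z"] by (simp add: sq)
      then show ?thesis unfolding bar_ring[OF F(2)] using F by (simp add: 6(3,4) G.m_assoc)
    qed
  qed
qed

text \<open>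
  The nesting relation is proved for \<open>X \<in> \<Lambda>\<close> (\<open>nest1\<close>) and then for all \<open>X\<close> (\<open>nest\<close>), because
  \<open>d\<^sub>X\<close> is a product of generators over \<open>\<Lambda>\<close>. Commutation is proved for pairs with a member in
  \<open>\<Lambda>\<close> (\<open>comm1\<close>), to which conjugation by such a generator (\<open>conj\<close>) reduces the rest.
\<close>

lemma cactus_relations_hold:
  assumes c: "c \<in> \<Lambda> \<rightarrow> carrier G" and sat: "satisfies G c \<Lambda> (section_relations W S m \<Lambda> \<Psi>)"
  defines "d \<equiv> \<lambda>X. c (bar X) \<otimes> c (ring X) \<otimes> c (bar X)"
  shows "d \<in> \<F> \<rightarrow> carrier G"
    and "X \<in> \<Lambda> \<Longrightarrow> d X = c X"
    and "satisfies G d \<F> (cactus_relations W S m)"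
proof -
  have cl [simp]: "c X \<in> carrier G" if "X \<in> \<Lambda>" for X using c that by auto
  have sq: "c X \<otimes> c X = \<one>" if X: "X \<in> \<Lambda>" for X
  proof -
    have "(pos [X, X], pos []) \<in> section_relations W S m \<Lambda> \<Psi>"
      using X by (auto simp: section_relations_def pos_def)
    from satisfies_pos[OF sat this] X show ?thesis by simp
  qed
  have d_eq: "d X = c (bar X) \<otimes> c (ring X) \<otimes> c (bar X)" for X by (simp add: d_def)
  have cancel: "c X \<otimes> (c X \<otimes> a) = a" if "X \<in> \<Lambda>" "a \<in> carrier G" for X a
    using that sq by (simp flip: G.m_assoc)
  have d [simp]: "d X \<in> carrier G" if "X \<in> \<F>" for X
    using bar_\<Lambda> ring_\<Lambda> that by (simp add: d_def)
  show "d \<in> \<F> \<rightarrow> carrier G" by simp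
  show d_\<Lambda>: "d X = c X" if "X \<in> \<Lambda>" for X
    using that by (simp add: d_def \<Psi>_\<Lambda> sq)
  have d_sq: "d X \<otimes> d X = \<one>" if "X \<in> \<F>" for X
    using bar_\<Lambda>[OF that] ring_\<Lambda>[OF that] by (simp add: d_def G.m_assoc cancel sq)
  \<comment> \<open>When \<open>\<Psi>(\<omega>\<^sub>X(Y)) = (X, Y)\<close>, there is no such relation, but then the equation is the definition of \<open>d\<close>.\<close>
  have \<Lambda>_nest: "c X \<otimes> c Y \<otimes> c X = d (\<omega> X Y)"
    if X: "X \<in> \<Lambda>" and Y: "Y \<in> Omega\<^sub>0 W S m X" "Y \<in> \<Lambda>" for X Y
  proof (cases "(X, Y) = \<Psi> (\<omega> X Y)")
    case True
    then have "bar (\<omega> X Y) = X" "ring (\<omega> X Y) = Y" by (metis fst_conv, metis snd_conv)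
    then show ?thesis by (simp add: d_def)
  next
    case False
    let ?Z = "\<omega> X Y"
    have "?Z \<in> \<F>" using cox.omega_conj_Omega\<^sub>0[OF \<Lambda>_\<F>[OF X] Y(1)] by (simp add: Omega\<^sub>0_def)
    then have Z: "bar ?Z \<in> \<Lambda>" "ring ?Z \<in> \<Lambda>" using bar_\<Lambda> ring_\<Lambda> by auto
    have "(pos [X, Y, X], pos [bar ?Z, ring ?Z, bar ?Z]) \<in> section_relations W S m \<Lambda> \<Psi>"
      using X Y False unfolding section_relations_def by blast
    from satisfies_pos[OF sat this] show ?thesis using X Y Z by (simp add: d_def G.m_assoc)
  qed
  have nest1: "c X \<otimes> d Y = d (\<omega> X Y) \<otimes> c X" if X: "X \<in> \<Lambda>" and Y: "Y \<in> Omega\<^sub>0 W S m X" for X Y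
  proof -
    \<comment> \<open>Since \<open>\<omega>\<^sub>X\<close> is an involution on \<open>\<Omega>\<^sub>0(X)\<close>, \<open>\<Lambda>_nest\<close> applies as soon as \<open>Y\<close> or \<open>\<omega>\<^sub>X(Y)\<close> is in \<open>\<Lambda>\<close>.\<close>
    let ?Z = "\<omega> X Y"
    have XF: "X \<in> \<F>" and YF: "Y \<in> \<F>" using X Y \<Lambda>_\<F> by (auto simp: Omega\<^sub>0_def)
    have Z: "?Z \<in> Omega\<^sub>0 W S m X" using cox.omega_conj_Omega\<^sub>0[OF XF Y] .
    then have ZF: "?Z \<in> \<F>" by (simp add: Omega\<^sub>0_def)
    have Y_eq: "\<omega> X ?Z = Y" using cox.omega_conj_omega_conj[OF XF] cox.fin_irredD(1)[OF YF] by simp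
    consider "Y \<in> \<Lambda>" | "?Z \<in> \<Lambda>" | "Y \<notin> \<Lambda>" "?Z \<notin> \<Lambda>" by blast
    then show ?thesis
    proof cases
      case 1
      then show ?thesis
        using \<Lambda>_nest[OF X Y] X by (simp add: d_\<Lambda> G.m_assoc sq flip: \<Lambda>_nest[OF X Y])
    next
      case 2
      then have "d Y = c X \<otimes> c ?Z \<otimes> c X" using \<Lambda>_nest[OF X Z] Y_eq by simp
      then show ?thesis using X 2 by (simp add: d_\<Lambda> G.m_assoc cancel)
    next
      case 3
      have L: "bar Y \<in> \<Lambda>" "ring Y \<in> \<Lambda>" "bar ?Z \<in> \<Lambda>" "ring ?Z \<in> \<Lambda>"
        using YF ZF bar_\<Lambda> ring_\<Lambda> by auto
      have "(bar Y, ring Y) \<in> \<Psi> ` (Omega\<^sub>0 W S m X - \<Lambda>)"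
        "(bar ?Z, ring ?Z) \<in> \<Psi> ` (Omega\<^sub>0 W S m X - \<Lambda>)"
        using Y Z 3 by auto
      moreover have "\<omega> (bar ?Z) (ring ?Z) = \<omega> X (\<omega> (bar Y) (ring Y))"
        by (simp add: \<omega>_bar_ring YF ZF)
      ultimately have "(pos [X, bar Y, ring Y, bar Y], pos [bar ?Z, ring ?Z, bar ?Z, X])
          \<in> section_relations W S m \<Lambda> \<Psi>"
        using X unfolding section_relations_def by blast
      from satisfies_pos[OF sat this] show ?thesis using X L by (simp add: d_def G.m_assoc)
    qed
  qed
  have nest: "d X \<otimes> d Y = d (\<omega> X Y) \<otimes> d X" if X: "X \<in> \<F>" and Y: "Y \<in> Omega\<^sub>0 W S m X" for X Y
  proof (cases "X \<in> \<Lambda>")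
    case True
    with nest1[OF True Y] show ?thesis by (simp add: d_\<Lambda>)
  next
    case False
    let ?B = "bar X" and ?R = "ring X"
    have L: "?B \<in> \<Lambda>" "?R \<in> \<Lambda>" and F: "?B \<in> \<F>" "?R \<in> \<F>" using X bar_\<Lambda> ring_\<Lambda> \<Lambda>_\<F> by auto
    have R: "?R \<in> Omega\<^sub>0 W S m ?B" using ring_Omega\<^sub>0_bar[OF X False] .
    have YF: "Y \<in> \<F>" and YX: "Y \<subset> X" using Y by (auto simp: Omega\<^sub>0_def)
    have XS: "X \<subseteq> S" and BS: "?B \<subseteq> S" and RS: "?R \<subseteq> S" using cox.fin_irredD(1) X F by auto
    have "X \<in> Omega\<^sub>0 W S m ?B"
      using cox.omega_conj_Omega\<^sub>0[OF F(1) R] \<omega>_bar_ring[OF X] by simp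
    \<comment> \<open>\<open>X\<close>, and with it \<open>Y\<close>, is properly contained in the first component of \<open>\<Psi> X\<close>.\<close>
    then have YB: "Y \<in> Omega\<^sub>0 W S m ?B" using YF YX by (auto simp: Omega\<^sub>0_def)
    \<comment> \<open>The sets that \<open>Y\<close> becomes on its way through the three factors of \<open>d\<^sub>X\<close>.\<close>
    define Y1 where "Y1 = \<omega> ?B Y"
    have "\<omega> ?B X = ?R" using cox.omega_conj_omega_conj[OF F(1) RS] \<omega>_bar_ring[OF X] by simp
    then have "Y1 \<subset> ?R" using cox.omega_conj_psubset[OF F(1) YX XS] by (simp add: Y1_def)
    moreover have Y1F: "Y1 \<in> \<F>" using cox.omega_conj_Omega\<^sub>0[OF F(1) YB] by (simp add: Y1_def Omega\<^sub>0_def)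
    ultimately have Y1: "Y1 \<in> Omega\<^sub>0 W S m ?R" by (simp add: Omega\<^sub>0_def)
    define Y2 where "Y2 = \<omega> ?R Y1"
    have Y2R: "Y2 \<in> Omega\<^sub>0 W S m ?R" using cox.omega_conj_Omega\<^sub>0[OF F(2) Y1] by (simp add: Y2_def)
    then have Y2: "Y2 \<in> Omega\<^sub>0 W S m ?B" and Y2F: "Y2 \<in> \<F>"
      using R by (auto simp: Omega\<^sub>0_def)
    define Y3 where "Y3 = \<omega> ?B Y2"
    have Y3F: "Y3 \<in> \<F>" using cox.omega_conj_Omega\<^sub>0[OF F(1) Y2] by (simp add: Y3_def Omega\<^sub>0_def)
    have Y3: "\<omega> X Y = Y3"
      using cox.omega_conj_conj[OF F, of Y] \<omega>_bar_ring[OF X] XS YX by (simp add: Y1_def Y2_def Y3_def)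
    have "d X \<otimes> d Y = c ?B \<otimes> (c ?R \<otimes> (c ?B \<otimes> d Y))"
      using L YF by (simp add: d_eq[of X] G.m_assoc)
    also have "c ?B \<otimes> d Y = d Y1 \<otimes> c ?B" using nest1[OF L(1) YB] by (simp add: Y1_def)
    also have "c ?R \<otimes> (d Y1 \<otimes> c ?B) = d Y2 \<otimes> c ?R \<otimes> c ?B"
      using nest1[OF L(2) Y1] L Y1F by (simp add: Y2_def flip: G.m_assoc)
    also have "c ?B \<otimes> (d Y2 \<otimes> c ?R \<otimes> c ?B) = d Y3 \<otimes> c ?B \<otimes> c ?R \<otimes> c ?B"
      using nest1[OF L(1) Y2] L Y2F by (simp add: Y3_def flip: G.m_assoc)
    also have "\<dots> = d (\<omega> X Y) \<otimes> d X" using L Y3F by (simp add: Y3 d_eq[of X] G.m_assoc)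
    finally show ?thesis .
  qed
  have comm1: "d Y \<otimes> d Z = d Z \<otimes> d Y"
    if Y: "Y \<in> \<F>" and Z: "Z \<in> \<Lambda>" and red: "\<not> irreducible_subset m (Y \<union> Z)" for Y Z
  proof -
    have YZ: "Y \<in> Omega\<^sub>1 W S m Z" using Y red by (simp add: Omega\<^sub>1_def)
    have ZF: "Z \<in> \<F>" using \<Lambda>_\<F>[OF Z] .
    have L: "bar Y \<in> \<Lambda>" "ring Y \<in> \<Lambda>" using Y bar_\<Lambda> ring_\<Lambda> by auto
    show ?thesis
    proof (cases "Y \<in> \<Lambda>")
      case True
      have "(pos [Z, Y, Z, Y], pos []) \<in> section_relations W S m \<Lambda> \<Psi>"
        using Z True YZ unfolding section_relations_def by (auto simp: pos_def)
      from satisfies_pos[OF sat this] have "c Z \<otimes> c Y \<otimes> (c Z \<otimes> c Y) = \<one>"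
        using Z True by (simp add: G.m_assoc)
      then show ?thesis
        using G.involutions_commute_iff[of "c Z" "c Y"] Z True by (simp add: sq d_\<Lambda>)
    next
      case False
      have "(bar Y, ring Y) \<in> \<Psi> ` (Omega\<^sub>1 W S m Z - \<Lambda>)" using YZ False by auto
      then have "(pos [bar Y, ring Y, bar Y, Z, bar Y, ring Y, bar Y, Z], pos [])
          \<in> section_relations W S m \<Lambda> \<Psi>"
        using Z unfolding section_relations_def pos_def[of "[]"] by (simp only: list.map) blast
      from satisfies_pos[OF sat this] have "d Y \<otimes> c Z \<otimes> (d Y \<otimes> c Z) = \<one>"
        using Z L by (simp add: d_eq[of Y] G.m_assoc)
      then show ?thesis
        using G.involutions_commute_iff[of "d Y" "c Z"] Z Y by (simp add: sq d_sq d_\<Lambda>)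
    qed
  qed
  have conj: "d (\<omega> X Y) = c X \<otimes> d Y \<otimes> c X" if X: "X \<in> \<Lambda>" and Y: "Y \<in> Omega W S m X" for X Y
  proof -
    have XF: "X \<in> \<F>" and F: "Y \<in> \<F>" "\<omega> X Y \<in> \<F>" using X Y \<Lambda>_\<F> Omega_\<F> by auto
    have "c X \<otimes> d Y = d (\<omega> X Y) \<otimes> c X"
      using cox.Omega_cases[OF XF Y]
    proof
      assume Y1: "Y \<in> Omega\<^sub>1 W S m X"
      then have "d Y \<otimes> d X = d X \<otimes> d Y" using X by (intro comm1) (auto simp: Omega\<^sub>1_def)
      then show ?thesis using X cox.omega_conj_Omega\<^sub>1[OF XF Y1] by (simp add: d_\<Lambda>)
    qed (rule nest1[OF X])
    then show ?thesis using X F by (simp add: G.m_assoc sq)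
  qed
  have comm: "d Y \<otimes> d Z = d Z \<otimes> d Y"
    if Y: "Y \<in> \<F>" and Z: "Z \<in> \<F>" and red: "\<not> irreducible_subset m (Y \<union> Z)" for Y Z
  proof -
    obtain X where X: "X \<in> \<Lambda>" and YX: "Y \<in> Omega W S m X" and ZX: "Z \<in> Omega W S m X"
      and \<Lambda>: "\<omega> X Y \<in> \<Lambda> \<or> \<omega> X Z \<in> \<Lambda>"
      using section_cover[OF Y Z red] by auto
    have XF: "X \<in> \<F>" using \<Lambda>_\<F>[OF X] .
    have F: "\<omega> X Y \<in> \<F>" "\<omega> X Z \<in> \<F>" using Omega_\<F>[OF XF] YX ZX by auto
    have red': "\<not> irreducible_subset m (\<omega> X Y \<union> \<omega> X Z)"
      using cox.fin_irredD(1) Y Z F by (intro cox.reducible_omega_conj[OF XF _ _ _ _ red]) auto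
    have "d (\<omega> X Y) \<otimes> d (\<omega> X Z) = d (\<omega> X Z) \<otimes> d (\<omega> X Y)"
      using \<Lambda>
    proof
      assume "\<omega> X Y \<in> \<Lambda>"
      with comm1[OF F(2)] red' show ?thesis by (simp add: Un_commute)
    qed (use comm1[OF F(1)] red' in simp)
    \<comment> \<open>Conjugate back by \<open>c\<^sub>X\<close>.\<close>
    then have "c X \<otimes> (d Y \<otimes> d Z) \<otimes> c X = c X \<otimes> (d Z \<otimes> d Y) \<otimes> c X"
      using X Y Z by (simp add: conj[OF X YX] conj[OF X ZX] G.m_assoc cancel)
    then show ?thesis using X Y Z by simp
  qed
  show "satisfies G d \<F> (cactus_relations W S m)"
    unfolding satisfies_def
  proof (intro ballI, clarify)
    fix u v assume "(u, v) \<in> cactus_relations W S m"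
    then consider
        (1) X where "X \<in> \<F>" "u = pos [X, X]" "v = []"
      | (2) X Y where "X \<in> \<F>" "Y \<in> Omega\<^sub>0 W S m X" "u = pos [X, Y]" "v = pos [\<omega> X Y, X]"
      | (3) X Y where "X \<in> \<F>" "Y \<in> Omega\<^sub>1 W S m X" "u = pos [Y, X]" "v = pos [X, Y]"
      unfolding cactus_relations_def by blast
    then show "signed_prod G d u = signed_prod G d v"
    proof cases
      case 1
      then show ?thesis by (simp add: d_sq)
    next
      case 2
      then have "Y \<in> \<F>" "\<omega> X Y \<in> \<F>"
        using cox.omega_conj_Omega\<^sub>0[of X Y] by (auto simp: Omega\<^sub>0_def)
      with 2 show ?thesis by (simp add: nest)
    next
      case 3
      then have "Y \<in> \<F>" "\<not> irreducible_subset m (Y \<union> X)" by (auto simp: Omega\<^sub>1_def)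
      with 3 show ?thesis by (simp add: comm)
    qed
  qed
qed

end

lemma cactus_sectionI:
  assumes "coxeter_system W S m" "is_section W S m \<Lambda> \<Psi>" "group G"
  shows "cactus_section W S m G \<Lambda> \<Psi>"
proof -
  have "group W" using assms(1) by (simp add: coxeter_system_def has_presentation_def)
  with assms show ?thesis
    by (intro cactus_section.intro coxeter.intro coxeter_axioms.intro cactus_section_axioms.intro)
qed

theorem theorem2p5:
  fixes W :: "('a, 'b) monoid_scheme"
    and S :: "'a set"
    and m :: "'a \<Rightarrow> 'a \<Rightarrow> enat"
    and \<Lambda> :: "'a set set"
    and \<Psi> :: "'a set \<Rightarrow> 'a set \<times> 'a set"
  assumes "coxeter_system W S m"
    and "is_section W S m \<Lambda> \<Psi>"
  shows "has_presentation (cactus_group W S m) \<Lambda> (section_relations W S m \<Lambda> \<Psi>)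
           (cactus_gen W S m)"
proof -
  let ?F = "fin_irred W S m" and ?Q = "cactus_relations W S m"
  let ?R = "section_relations W S m \<Lambda> \<Psi>"
  let ?C = "presented_group ?F ?Q" and ?c = "pres_gen ?F ?Q"
  let ?P = "presented_group \<Lambda> ?R" and ?p = "pres_gen \<Lambda> ?R"
  interpret C: cactus_section W S m ?C \<Lambda> \<Psi>
    by (intro cactus_sectionI assms group_presented_group)
  interpret P: cactus_section W S m ?P \<Lambda> \<Psi>
    by (intro cactus_sectionI assms group_presented_group)
  have c: "?c \<in> ?F \<rightarrow> carrier ?C" "?c \<in> \<Lambda> \<rightarrow> carrier ?C" and p: "?p \<in> \<Lambda> \<rightarrow> carrier ?P"
    using C.\<Lambda>_\<F> by auto
  note c_rels = C.section_relations_hold[OF c(1) pres_gen_satisfies]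
  define d where "d X = ?p (fst (\<Psi> X)) \<otimes>\<^bsub>?P\<^esub> ?p (snd (\<Psi> X)) \<otimes>\<^bsub>?P\<^esub> ?p (fst (\<Psi> X))" for X
  note d_rels = P.cactus_relations_hold[OF p pres_gen_satisfies, folded d_def]
  obtain f where f: "f \<in> hom ?P ?C" "\<And>X. X \<in> \<Lambda> \<Longrightarrow> f (?p X) = ?c X"
    using group.presented_group_universal[OF group_presented_group c(2) c_rels(2)] by blast
  obtain g where g: "g \<in> hom ?C ?P" "\<And>X. X \<in> ?F \<Longrightarrow> g (?c X) = d X"
    using group.presented_group_universal[OF group_presented_group d_rels(1,3)] by blast
  have "f (d X) = ?c X" if X: "X \<in> ?F" for X
  proof -
    have "fst (\<Psi> X) \<in> \<Lambda>" "snd (\<Psi> X) \<in> \<Lambda>" using X C.bar_\<Lambda> C.ring_\<Lambda> by auto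
    with c_rels(1)[OF X] show ?thesis by (simp add: d_def hom_mult[OF f(1)] f(2))
  qed
  with f g C.\<Lambda>_\<F> d_rels(2) have "has_presentation ?C \<Lambda> ?R ?c"
    by (intro has_presentation_presented_groupI[of f _ _ _ _ g]) auto
  then show ?thesis by (simp only: cactus_group_def cactus_gen_def)
qed

end
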